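(* For all integers $d,m\ge 1$, all $B>0$ and all $n\ge 1$: \begin{align*} e_n(\mathcal F_{d,m,B},S_L,D_{\mathrm{abs}})&=\Theta_{m,d}(Bn^{-m/d}), & e^{\mathrm{ad}}_n(\mathcal F_{d,m,B},S_L,D_{\mathrm{abs}})&=\Theta_{m,d}(Bn^{-m/d}),\\ e_n(\mathcal F_{d,m,B},S_{\mathrm{samp}},D_{\sup\text{-}\log})&=\Theta_{m,d}(Bn^{-m/d}), & e^{\mathrm{ad}}_n(\mathcal F_{d,m,B},S_{\mathrm{samp}},D_{\sup\text{-}\log})&=\Theta_{m,d}(Bn^{-m/d}),\\ e_n(\mathcal F_{d,m,B},S_{\mathrm{samp}},D_{\mathrm{TV}})&=\Theta_{m,d}(\min\{1,Bn^{-m/d}\}), & e^{\mathrm{ad}}_n(\mathcal F_{d,m,B},S_{\mathrm{samp}},D_{\mathrm{TV}})&=\Theta_{m,d}(\min\{1,Bn^{-m/d}\}),\\ e_n(\mathcal F_{d,m,B},S_{\mathrm{samp}},W_1)&=\Theta_{m,d}(\min\{1,Bn^{-m/d}\}), & e^{\mathrm{ad}}_n(\mathcal F_{d,m,B},S_{\mathrm{samp}},W_1)&=\Theta_{m,d}(\min\{1,Bn^{-m/d}\}). \end{align*}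
   Context: Let $\mathcal X=[0,1]^d$ with Lebesgue measure. For bounded measurable $f:\mathcal X\to\mathbb R$ let $Z_f=\int_{\mathcal X}e^{f(x)}\,dx$, $L_f=\log Z_f$, and $P_f$ the probability distribution on $\mathcal X$ with density $e^{f}/Z_f$. For $f\in C^m(\mathcal X)$, $\|f\|_{C^m}=\sup_{\alpha\in\mathbb N_0^d,|\alpha|_1\le m}\|\partial^\alpha f\|_\infty$, and $\mathcal F_{d,m,B}=\{f\in C^m(\mathcal X):\|f\|_{C^m}\le B\}$. Problems: $S_L(f)=L_f$ with metric $D_{\mathrm{abs}}(a,b)=|a-b|$ on $\mathbb R$; $S_{\mathrm{samp}}(f)=P_f$ with values in the set of probability distributions on $\mathcal X$, compared with: the sup-log distance $D_{\sup\text{-}\log}(P,Q)=\|\log(dP/dQ)\|_\infty$ (essential sup over $\mathcal X$; $=\infty$ unless $P,Q$ are mutually absolutely continuous), the total variation distance $D_{\mathrm{TV}}(P,Q)=\sup_{A\text{ measurable}}|P(A)-Q(A)|$, and the 1-Wasserstein distance $W_1(P,Q)=\inf_{X\sim P,Y\sim Q}\mathbb E\|X-Y\|_2$. Algorithms: $\mathcal A_n$ is the set of maps $\tilde S=\phi\circ N$ with $N(f)=(f(x_1),\dots,f(x_n))$ for some fixed points $x_1,\dots,x_n\in\mathcal X$ and an arbitrary map $\phi$ from $\mathbb R^n$ to the output space; $\mathcal A^{\mathrm{ad}}_n$ is the analogous set where the $k$-th point $x_k$ may depend on $f(x_1),\dots,f(x_{k-1})$. For a class $\mathcal F$, problem $S$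 and metric $D$: $e_n(\mathcal F,S,D)=\inf_{\tilde S\in\mathcal A_n}\sup_{f\in\mathcal F}D(S(f),\tilde S(f))$ and $e^{\mathrm{ad}}_n$ likewise with $\mathcal A^{\mathrm{ad}}_n$. Asymptotic notation: $g\le O_{m,d}(h)$ means that for all $m,d$ there is $C_{m,d}>0$ with $g\le C_{m,d}h$ for all $B>0$ and all $n\ge1$; $g\ge\Omega_{m,d}(h)$ means $h\le O_{m,d}(g)$; $\Theta_{m,d}$ means both. *)

theory Defs
  imports "HOL-Probability.Probability"
begin

definition cube :: "(real^'d) set" where
  "cube = {x. \<forall>i. 0 \<le> x $ i \<and> x $ i \<le> 1}"

definition has_partial_within :: "(real^'d) set \<Rightarrow> 'd \<Rightarrow> (real^'d \<Rightarrow> real) \<Rightarrow> real \<Rightarrow> real^'d \<Rightarrow> bool" where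
  "has_partial_within X i f D x \<longleftrightarrow>
     ((\<lambda>t. f (x + t *\<^sub>R axis i 1)) has_real_derivative D) (at 0 within {t. x + t *\<^sub>R axis i 1 \<in> X})"

text \<open>Cm_bdd m B X f: f is C^m on X and every partial derivative of order at most m
  is bounded by B in sup norm on X, i.e. norm of f in C^m is at most B.\<close>
primrec Cm_bdd :: "nat \<Rightarrow> real \<Rightarrow> (real^'d) set \<Rightarrow> (real^'d \<Rightarrow> real) \<Rightarrow> bool" where
  "Cm_bdd 0 B X f \<longleftrightarrow> continuous_on X f \<and> (\<forall>x\<in>X. \<bar>f x\<bar> \<le> B)"
| "Cm_bdd (Suc k) B X f \<longleftrightarrow> continuous_on X f \<and> (\<forall>x\<in>X. \<bar>f x\<bar> \<le> B) \<and>
     (\<forall>i. \<exists>g. (\<forall>x\<in>X. has_partial_within X i f (g x) x) \<and> Cm_bdd k B X g)"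

definition Fcls :: "nat \<Rightarrow> real \<Rightarrow> (real^'d \<Rightarrow> real) set" where
  "Fcls m B = {f. Cm_bdd m B cube f}"

definition Zf :: "(real^'d \<Rightarrow> real) \<Rightarrow> real" where
  "Zf f = (LINT x:cube|lborel. exp (f x))"

definition Lf :: "(real^'d \<Rightarrow> real) \<Rightarrow> real" where
  "Lf f = ln (Zf f)"

definition Pf :: "(real^'d \<Rightarrow> real) \<Rightarrow> (real^'d) measure" where
  "Pf f = density lborel (\<lambda>x. ennreal (indicator cube x * exp (f x) / Zf f))"

definition Dists :: "(real^'d) measure set" where
  "Dists = {M. sets M = sets borel \<and> prob_space M \<and> emeasure M cube = 1}"

definition abs_dist :: "real \<Rightarrow> real \<Rightarrow> ereal" where
  "abs_dist a b = ereal \<bar>a - b\<bar>"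

definition suplog_dist :: "(real^'d) measure \<Rightarrow> (real^'d) measure \<Rightarrow> ereal" where
  "suplog_dist P Q =
     (if absolutely_continuous P Q \<and> absolutely_continuous Q P
      then esssup Q (\<lambda>x. ereal \<bar>ln (enn2real (RN_deriv Q P x))\<bar>)
      else \<infinity>)"

definition tv_dist :: "(real^'d) measure \<Rightarrow> (real^'d) measure \<Rightarrow> ereal" where
  "tv_dist P Q = ereal (SUP A\<in>sets (borel :: (real^'d) measure). \<bar>measure P A - measure Q A\<bar>)"

definition couplings :: "(real^'d) measure \<Rightarrow> (real^'d) measure \<Rightarrow> ((real^'d) \<times> (real^'d)) measure set" where
  "couplings P Q = {\<pi>. sets \<pi> = sets borel \<and> prob_space \<pi> \<and>
                       distr \<pi> borel fst = P \<and> distr \<pi> borel snd = Q}"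

definition w1_dist :: "(real^'d) measure \<Rightarrow> (real^'d) measure \<Rightarrow> ereal" where
  "w1_dist P Q = enn2ereal (INF \<pi>\<in>couplings P Q. \<integral>\<^sup>+ z. ennreal (norm (fst z - snd z)) \<partial>\<pi>)"

definition err_na :: "nat \<Rightarrow> 'x set \<Rightarrow> ('x \<Rightarrow> real) set \<Rightarrow> (('x \<Rightarrow> real) \<Rightarrow> 'o) \<Rightarrow> 'o set
                       \<Rightarrow> ('o \<Rightarrow> 'o \<Rightarrow> ereal) \<Rightarrow> ereal" where
  "err_na n X F S Out D =
     (INF xs\<in>{xs. length xs = n \<and> set xs \<subseteq> X}. INF \<phi>\<in>{\<phi>. \<forall>v. \<phi> v \<in> Out}.
        SUP f\<in>F. D (S f) (\<phi> (map f xs)))"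

primrec ad_info :: "(real list \<Rightarrow> 'x) \<Rightarrow> ('x \<Rightarrow> real) \<Rightarrow> nat \<Rightarrow> real list" where
  "ad_info pt f 0 = []"
| "ad_info pt f (Suc k) = ad_info pt f k @ [f (pt (ad_info pt f k))]"

definition err_ad :: "nat \<Rightarrow> 'x set \<Rightarrow> ('x \<Rightarrow> real) set \<Rightarrow> (('x \<Rightarrow> real) \<Rightarrow> 'o) \<Rightarrow> 'o set
                       \<Rightarrow> ('o \<Rightarrow> 'o \<Rightarrow> ereal) \<Rightarrow> ereal" where
  "err_ad n X F S Out D =
     (INF pt\<in>{pt. \<forall>v. pt v \<in> X}. INF \<phi>\<in>{\<phi>. \<forall>v. \<phi> v \<in> Out}.
        SUP f\<in>F. D (S f) (\<phi> (ad_info pt f n)))"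

definition Theta :: "(real \<Rightarrow> nat \<Rightarrow> ereal) \<Rightarrow> (real \<Rightarrow> nat \<Rightarrow> real) \<Rightarrow> bool" where
  "Theta e h \<longleftrightarrow>
     (\<exists>C>0. \<forall>B>0. \<forall>n\<ge>1. e B n \<le> ereal (C * h B n)) \<and>
     (\<exists>C>0. \<forall>B>0. \<forall>n\<ge>1. ereal (h B n) \<le> ereal C * e B n)"

end

theory Submission
  imports Defs
begin

text \<open>
  Upper bounds: on a grid with at most \<open>n\<close> points, answer with \<open>S g\<close> for any \<open>g\<close> in the class that
  matches the data. The difference \<open>f - g\<close> has bounded derivatives of order \<open>m\<close> and vanishes on the
  grid, so it is of size \<open>B * n powr (- m/d)\<close>; no interpolation operator is needed. Along a single
  coordinate this follows by induction on \<open>m\<close>: the mean value theorem on consecutive pairs of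
  \<open>2^m\<close> separated points yields \<open>2^(m-1)\<close> separated points where the derivative is small. The
  remaining coordinates are freed one at a time. All four quantities are stable under uniform
  perturbations of \<open>f\<close>.

  Lower bounds: place bumps of height of order \<open>B * n powr (- m/d)\<close> in the cells of the half cube
  \<open>x $ i \<le> 1/2\<close> that contain no point queried for the zero function. The result \<open>f\<close> cannot be told
  apart from \<open>0\<close>. Jensen's inequality gives \<open>ln Z\<^sub>f \<ge> c * B * n powr (- m/d)\<close>, and every
  expectation of a function supported in the other half is divided by \<open>Z\<^sub>f\<close>.
\<close>

subsection \<open>The sampling inequality\<close>

text \<open>The upper bound uses only the pure derivatives in each coordinate direction, so
  one-variable calculus on coordinate lines suffices. With fewer than \<open>2^m\<close> nodes per
  direction there is no room for the halving; but then \<open>n\<close> is bounded in terms of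
  \<open>m\<close> and \<open>d\<close>, and the trivial bound by \<open>B\<close> already has the
  right order.

  In the lower bound a single bump would be too weak, since its integral carries the volume of a
  cell. Filling a fixed fraction of all cells keeps the norm under control, because at most two
  translates per coordinate overlap, and makes the integral comparable to the height. The bumps stay
  in one half because distributions are compared after normalisation: on the other half the density
  changes exactly by the factor \<open>1 / Z\<^sub>f\<close>, so the effect on a functional is
  computed instead of estimated. This also settles the Wasserstein case. Mass shifted inside a cell
  would travel at most a cell diameter and lose a factor \<open>n powr (- 1/d)\<close>, whereas here
  mass has to leave the other half, which a fixed 1-Lipschitz function detects without loss.\<close>

text \<open>The hypothesis on \<open>R\<close> ties the length of the interval to the spacing, so
  that \<open>C\<close> depends on \<open>m\<close> and \<open>R\<close> alone. A tolerance
  \<open>\<epsilon>\<close> at the nodes is allowed, instead of exact zeros, for two reasons: the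
  induction passes from values to difference quotients, and in several variables the values at the
  nodes are themselves only estimated.\<close>

lemma sampling_inequality_1d:
  fixes R :: real
  assumes "R \<ge> 0"
  shows "\<exists>C\<ge>0. \<forall>(G::nat \<Rightarrow> real \<Rightarrow> real) B \<epsilon> a b \<delta> (x::nat \<Rightarrow> real).
     0 < \<delta> \<longrightarrow> b - a \<le> R * \<delta> \<longrightarrow>
     (\<forall>l<m. \<forall>t\<in>{a..b}. (G l has_real_derivative G (Suc l) t) (at t within {a..b})) \<longrightarrow>
     (\<forall>t\<in>{a..b}. \<bar>G m t\<bar> \<le> B) \<longrightarrow>
     (\<forall>i<2^m. x i \<in> {a..b} \<and> \<bar>G 0 (x i)\<bar> \<le> \<epsilon>) \<longrightarrow>
     (\<forall>i. Suc i < 2^m \<longrightarrow> x i + \<delta> \<le> x (Suc i)) \<longrightarrow>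
     (\<forall>t\<in>{a..b}. \<bar>G 0 t\<bar> \<le> C * (\<epsilon> + B * \<delta>^m))"
proof (induction m)
  case 0
  show ?case
    by (rule exI[of _ 1]) force
next
  case (Suc m)
  then obtain C where C0: "C \<ge> 0" and C: "\<And>(G::nat \<Rightarrow> real \<Rightarrow> real) B \<epsilon> a b \<delta> (x::nat \<Rightarrow> real).
     0 < \<delta> \<Longrightarrow> b - a \<le> R * \<delta> \<Longrightarrow>
     (\<forall>l<m. \<forall>t\<in>{a..b}. (G l has_real_derivative G (Suc l) t) (at t within {a..b})) \<Longrightarrow>
     (\<forall>t\<in>{a..b}. \<bar>G m t\<bar> \<le> B) \<Longrightarrow>
     (\<forall>i<2^m. x i \<in> {a..b} \<and> \<bar>G 0 (x i)\<bar> \<le> \<epsilon>) \<Longrightarrow>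
     (\<forall>i. Suc i < 2^m \<longrightarrow> x i + \<delta> \<le> x (Suc i)) \<Longrightarrow>
     (\<forall>t\<in>{a..b}. \<bar>G 0 t\<bar> \<le> C * (\<epsilon> + B * \<delta>^m))"
    by blast
  show ?case
  proof (intro exI[of _ "1 + 2 * R * C"] conjI allI impI ballI)
    show "0 \<le> 1 + 2 * R * C" using C0 assms by simp
  next
    fix G :: "nat \<Rightarrow> real \<Rightarrow> real" and B \<epsilon> a b \<delta> t :: real and x :: "nat \<Rightarrow> real"
    assume d: "0 < \<delta>" and ab: "b - a \<le> R * \<delta>"
      and G: "\<forall>l<Suc m. \<forall>t\<in>{a..b}. (G l has_real_derivative G (Suc l) t) (at t within {a..b})"
      and B: "\<forall>t\<in>{a..b}. \<bar>G (Suc m) t\<bar> \<le> B"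
      and x: "\<forall>i<2 ^ Suc m. x i \<in> {a..b} \<and> \<bar>G 0 (x i)\<bar> \<le> \<epsilon>"
      and sep: "\<forall>i. Suc i < 2 ^ Suc m \<longrightarrow> x i + \<delta> \<le> x (Suc i)"
      and t: "t \<in> {a..b}"
    have G0: "(G 0 has_real_derivative G 1 s) (at s within {a..b})" if "s \<in> {a..b}" for s
      using G that by auto
    have "\<exists>y. x (2*i) \<le> y \<and> y \<le> x (2*i+1) \<and> \<bar>G 1 y\<bar> \<le> 2 * \<epsilon> / \<delta>" if i: "i < 2^m" for i
    proof -
      have i1: "Suc (2*i) < 2 ^ Suc m" using i by simp
      have x1: "x (2*i) \<in> {a..b}" "x (2*i+1) \<in> {a..b}" "\<bar>G 0 (x (2*i))\<bar> \<le> \<epsilon>" "\<bar>G 0 (x (2*i+1))\<bar> \<le> \<epsilon>"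
        using x i1 by auto
      have s: "x (2*i) + \<delta> \<le> x (2*i+1)" using sep i1 by auto
      have "\<exists>y\<in>{x (2*i)<..<x (2*i+1)}. G 0 (x (2*i+1)) - G 0 (x (2*i)) = (\<lambda>h. G 1 y * h) (x (2*i+1) - x (2*i))"
      proof (rule mvt_simple)
        show "x (2*i) < x (2*i+1)" using s d by simp
        fix s assume "x (2*i) \<le> s" "s \<le> x (2*i+1)"
        then show "(G 0 has_derivative (\<lambda>h. G 1 s * h)) (at s within {x (2*i)..x (2*i+1)})"
          using G0[of s] x1 by (auto simp: has_field_derivative_def intro: has_derivative_subset)
      qed
      then obtain y where y: "y\<in>{x (2*i)<..<x (2*i+1)}"
        "G 0 (x (2*i+1)) - G 0 (x (2*i)) = G 1 y * (x (2*i+1) - x (2*i))" by auto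
      have "\<bar>G 1 y\<bar> * \<delta> \<le> \<bar>G 1 y\<bar> * (x (2*i+1) - x (2*i))"
        using s by (intro mult_left_mono) auto
      also have "\<dots> = \<bar>G 0 (x (2*i+1)) - G 0 (x (2*i))\<bar>"
        using y s d by (simp add: abs_mult)
      also have "\<dots> \<le> 2 * \<epsilon>" using x1 by linarith
      finally have "\<bar>G 1 y\<bar> \<le> 2 * \<epsilon> / \<delta>" using d by (simp add: field_simps)
      then show ?thesis using y by (intro exI[of _ y]) auto
    qed
    then obtain y where y: "\<And>i. i < 2^m \<Longrightarrow> x (2*i) \<le> y i \<and> y i \<le> x (2*i+1) \<and> \<bar>G 1 (y i)\<bar> \<le> 2 * \<epsilon> / \<delta>"
      by metis
    have "\<forall>t\<in>{a..b}. \<bar>(\<lambda>l. G (Suc l)) 0 t\<bar> \<le> C * (2 * \<epsilon> / \<delta> + B * \<delta>^m)"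
    proof (rule C[OF d ab, where x = y])
      show "\<forall>l<m. \<forall>t\<in>{a..b}. (G (Suc l) has_real_derivative G (Suc (Suc l)) t) (at t within {a..b})"
        using G by auto
      show "\<forall>i<2 ^ m. y i \<in> {a..b} \<and> \<bar>G (Suc 0) (y i)\<bar> \<le> 2 * \<epsilon> / \<delta>"
      proof (intro allI impI)
        fix i :: nat assume i: "i < 2^m"
        then have "x (2*i) \<in> {a..b}" "x (2*i+1) \<in> {a..b}" using x by auto
        then show "y i \<in> {a..b} \<and> \<bar>G (Suc 0) (y i)\<bar> \<le> 2 * \<epsilon> / \<delta>" using y[OF i] by auto
      qed
      \<comment> \<open>Consecutive mean value points stay \<open>\<delta>\<close> apart because the
        gap between \<open>x (2*i+1)\<close> and \<open>x (2*i+2)\<close> lies between them.\<close>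
      show "\<forall>i. Suc i < 2 ^ m \<longrightarrow> y i + \<delta> \<le> y (Suc i)"
      proof (intro allI impI)
        fix i :: nat assume i: "Suc i < 2^m"
        have "y i \<le> x (2*i+1)" "x (2 * Suc i) \<le> y (Suc i)" using y[of i] y[of "Suc i"] i by auto
        moreover have "x (2*i+1) + \<delta> \<le> x (Suc (2*i+1))" using sep i by auto
        ultimately show "y i + \<delta> \<le> y (Suc i)" by simp
      qed
    qed (use B in auto)
    then have G1: "\<bar>G 1 s\<bar> \<le> C * (2 * \<epsilon> / \<delta> + B * \<delta>^m)" if "s \<in> {a..b}" for s
      using that by auto
    have x0: "x 0 \<in> {a..b}" "\<bar>G 0 (x 0)\<bar> \<le> \<epsilon>" using x by auto
    have B0: "B \<ge> 0" using B t abs_ge_zero[of "G (Suc m) t"] by force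
    have e0: "\<epsilon> \<ge> 0" using x0 by linarith
    \<comment> \<open>Going back from the derivative to \<open>G 0\<close> over a length of at most
      \<open>R * \<delta>\<close> turns \<open>2 * \<epsilon> / \<delta>\<close> into
      \<open>2 * R * \<epsilon>\<close> and supplies the missing power of \<open>\<delta>\<close>;
      the base value at \<open>x 0\<close> adds one more \<open>\<epsilon>\<close>.\<close>
    have "norm (G 0 t - G 0 (x 0)) \<le> (C * (2 * \<epsilon> / \<delta> + B * \<delta>^m)) * norm (t - x 0)"
      by (rule field_differentiable_bound[of "{a..b}" "G 0" "G 1"]) (use G0 G1 t x0 in auto)
    also have "\<dots> \<le> (C * (2 * \<epsilon> / \<delta> + B * \<delta>^m)) * (R * \<delta>)"
      using C0 B0 e0 d ab t x0 by (intro mult_left_mono) auto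
    also have "\<dots> = 2 * R * C * \<epsilon> + R * C * B * \<delta>^Suc m"
      using d by (simp add: field_simps)
    also have "\<dots> \<le> 2 * R * C * \<epsilon> + (1 + 2 * R * C) * (B * \<delta>^Suc m)"
    proof -
      have "0 \<le> R * C * (B * \<delta>^Suc m)" "0 \<le> B * \<delta>^Suc m" using C0 B0 d assms by auto
      then show ?thesis by (simp add: algebra_simps)
    qed
    finally show "\<bar>G 0 t\<bar> \<le> (1 + 2 * R * C) * (\<epsilon> + B * \<delta> ^ Suc m)"
      using x0 by (simp add: algebra_simps)
  qed
qed

section \<open>Restriction to coordinate lines\<close>

definition upd_coord :: "real^'d \<Rightarrow> 'd \<Rightarrow> real \<Rightarrow> real^'d" where
  "upd_coord x i t = x + (t - x $ i) *\<^sub>R axis i 1"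

lemma upd_coord_nth: "upd_coord x i t $ j = (if j = i then t else x $ j)"
  by (simp add: upd_coord_def axis_def)

lemma upd_coord_in_cube: "x \<in> cube \<Longrightarrow> upd_coord x i t \<in> cube \<longleftrightarrow> t \<in> {0..1}"
  by (auto simp: cube_def upd_coord_nth split: if_splits)

lemma upd_coord_self: "upd_coord x i (x $ i) = x"
  by (simp add: upd_coord_def)

lemma upd_coord_shift: "upd_coord x i t + s *\<^sub>R axis i 1 = upd_coord x i (t + s)"
  by (simp add: vec_eq_iff upd_coord_nth axis_def)

text \<open>\<open>has_partial_within\<close> differentiates at increment 0 within the set of
  admissible increments. For a line through the cube this set is \<open>{0..1}\<close> shifted by
  \<open>- t\<close>, so a chain rule with a translation gives the usual derivative, one-sided at
  the two ends.\<close>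

lemma has_partial_line:
  assumes "x \<in> cube" "t \<in> {0..1}" "has_partial_within cube i f D (upd_coord x i t)"
  shows "((\<lambda>s. f (upd_coord x i s)) has_real_derivative D) (at t within {0..1})"
proof -
  have "(\<lambda>s. s - t) ` {0..1} = {s. upd_coord x i (t + s) \<in> cube}"
    using upd_coord_in_cube[OF assms(1)]
    by (auto simp: image_iff intro!: bexI[of _ "t + _"])
  then have "((\<lambda>s. f (upd_coord x i (t + s))) has_real_derivative D) (at (t - t) within (\<lambda>s. s - t) ` {0..1})"
    using assms(3) by (simp add: has_partial_within_def upd_coord_shift)
  then have "((\<lambda>s. f (upd_coord x i (t + s))) \<circ> (\<lambda>s. s - t) has_real_derivative D * 1) (at t within {0..1})"
    by (rule DERIV_image_chain) (auto intro!: derivative_eq_intros)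
  then show ?thesis by (simp add: o_def)
qed

lemma Cm_bdd_abs_le: "Cm_bdd m B X f \<Longrightarrow> x \<in> X \<Longrightarrow> \<bar>f x\<bar> \<le> B"
  by (cases m) auto

lemma Cm_bdd_continuous_on: "Cm_bdd m B X f \<Longrightarrow> continuous_on X f"
  by (cases m) auto

text \<open>Unfolding \<open>Cm_bdd\<close> along the fixed direction \<open>i\<close> yields one
  witness per order; \<open>G\<close> collects their restrictions to the line.\<close>

lemma Cm_bdd_line_derivs:
  assumes "Cm_bdd m B cube f" "x \<in> cube"
  shows "\<exists>G. G 0 = (\<lambda>t. f (upd_coord x i t)) \<and>
    (\<forall>l<m. \<forall>t\<in>{0..1}. (G l has_real_derivative G (Suc l) t) (at t within {0..1})) \<and>
    (\<forall>t\<in>{0..1}. \<bar>G m t\<bar> \<le> B)"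
  using assms(1)
proof (induction m arbitrary: f)
  case 0
  then show ?case
    using upd_coord_in_cube[OF assms(2)] by (intro exI[of _ "\<lambda>_ t. f (upd_coord x i t)"]) auto
next
  case (Suc m)
  then obtain g where g: "\<And>y. y \<in> cube \<Longrightarrow> has_partial_within cube i f (g y) y" "Cm_bdd m B cube g"
    using Suc.prems by (metis Cm_bdd.simps(2))
  from Suc.IH[OF g(2)] obtain G where G: "G 0 = (\<lambda>t. g (upd_coord x i t))"
    "\<forall>l<m. \<forall>t\<in>{0..1}. (G l has_real_derivative G (Suc l) t) (at t within {0..1})"
    "\<forall>t\<in>{0..1}. \<bar>G m t\<bar> \<le> B" by blast
  let ?G = "\<lambda>l. case l of 0 \<Rightarrow> (\<lambda>t. f (upd_coord x i t)) | Suc l \<Rightarrow> G l"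
  show ?case
  proof (intro exI[of _ ?G] conjI allI impI ballI)
    fix l and t :: real assume l: "l < Suc m" and t: "t \<in> {0..1}"
    show "(?G l has_real_derivative ?G (Suc l) t) (at t within {0..1})"
    proof (cases l)
      case 0
      have "((\<lambda>s. f (upd_coord x i s)) has_real_derivative g (upd_coord x i t)) (at t within {0..1})"
        by (rule has_partial_line[OF assms(2) t]) (use g(1) upd_coord_in_cube[OF assms(2)] t in auto)
      then show ?thesis using 0 G(1) by simp
    next
      case (Suc l')
      then show ?thesis using G(2) l t by simp
    qed
  qed (use G(3) in auto)
qed

lemma has_partial_diff:
  "has_partial_within X i f D x \<Longrightarrow> has_partial_within X i g E x \<Longrightarrow>
   has_partial_within X i (\<lambda>x. f x - g x) (D - E) x"
  unfolding has_partial_within_def by (rule DERIV_diff)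

lemma Cm_bdd_diff:
  "Cm_bdd m B X f \<Longrightarrow> Cm_bdd m B' X g \<Longrightarrow> Cm_bdd m (B + B') X (\<lambda>x. f x - g x)"
proof (induction m arbitrary: f g)
  case 0
  then show ?case by (auto intro!: continuous_intros) (smt (verit, best))
next
  case (Suc m)
  have "\<exists>h. (\<forall>x\<in>X. has_partial_within X i (\<lambda>x. f x - g x) (h x) x) \<and> Cm_bdd m (B + B') X h" for i
  proof -
    obtain f' g' where "\<forall>x\<in>X. has_partial_within X i f (f' x) x" "Cm_bdd m B X f'"
      "\<forall>x\<in>X. has_partial_within X i g (g' x) x" "Cm_bdd m B' X g'"
      using Suc.prems by (auto dest!: spec[of _ i])
    then show ?thesis
      using Suc.IH by (intro exI[of _ "\<lambda>x. f' x - g' x"]) (auto intro: has_partial_diff)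
  qed
  moreover have "\<bar>f x - g x\<bar> \<le> B + B'" if "x \<in> X" for x
    using Cm_bdd_abs_le[OF Suc.prems(1) that] Cm_bdd_abs_le[OF Suc.prems(2) that] by linarith
  ultimately show ?case
    using Suc.prems by (auto intro!: continuous_intros)
qed

section \<open>Sampling on product grids\<close>

text \<open>Coordinates stop at \<open>(k - 1) / k\<close>, which keeps the number of points at
  \<open>k ^ CARD('d)\<close>. The last cell still gets covered, since a window of
  \<open>2^m\<close> cells may end at 1 without a node there.\<close>

definition grid :: "nat \<Rightarrow> (real^'d) set" where
  "grid k = {x. \<forall>i. \<exists>j<k. x $ i = real j / real k}"

text \<open>\<open>S\<close> holds the freed coordinates, the others are pinned to grid values. To
  free \<open>i\<close>, the one-variable inequality is applied on the line in direction
  \<open>i\<close>: at its nodes the bound for \<open>S\<close> serves as \<open>\<epsilon>\<close>,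
  which is of the same order as the new term, so only the constant grows.\<close>

lemma grid_sampling_partial:
  fixes S :: "'d::finite set"
  shows "\<exists>C\<ge>0. \<forall>B k (h :: real^'d \<Rightarrow> real). Cm_bdd m B cube h \<longrightarrow> 2^m \<le> k \<longrightarrow> (\<forall>x\<in>grid k. h x = 0) \<longrightarrow>
    (\<forall>x\<in>cube. (\<forall>i. i \<notin> S \<longrightarrow> (\<exists>j<k. x $ i = real j / real k)) \<longrightarrow> \<bar>h x\<bar> \<le> C * (B * (1 / real k)^m))"
  using finite[of S]
proof (induction S rule: finite_induct)
  case empty
  show ?case by (rule exI[of _ 0]) (auto simp: grid_def)
next
  case (insert i S)
  then obtain C where C0: "C \<ge> 0" and C: "\<And>B k (h :: real^'d \<Rightarrow> real) x. Cm_bdd m B cube h \<Longrightarrow> 2^m \<le> k \<Longrightarrow> (\<forall>x\<in>grid k. h x = 0) \<Longrightarrow>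
    x\<in>cube \<Longrightarrow> (\<forall>i. i \<notin> S \<longrightarrow> (\<exists>j<k. x $ i = real j / real k)) \<Longrightarrow> \<bar>h x\<bar> \<le> C * (B * (1 / real k)^m)"
    by metis
  \<comment> \<open>A window of \<open>2^m\<close> cells of width \<open>\<delta> = 1 / k\<close>
    has length \<open>2^m * \<delta>\<close>; this is the value of \<open>R\<close>.\<close>
  obtain C1 where C1: "C1 \<ge> 0" "\<And>(G::nat \<Rightarrow> real \<Rightarrow> real) B \<epsilon> a b \<delta> (x::nat \<Rightarrow> real) t.
     0 < \<delta> \<Longrightarrow> b - a \<le> real (2^m) * \<delta> \<Longrightarrow>
     (\<forall>l<m. \<forall>t\<in>{a..b}. (G l has_real_derivative G (Suc l) t) (at t within {a..b})) \<Longrightarrow>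
     (\<forall>t\<in>{a..b}. \<bar>G m t\<bar> \<le> B) \<Longrightarrow>
     (\<forall>i<2^m. x i \<in> {a..b} \<and> \<bar>G 0 (x i)\<bar> \<le> \<epsilon>) \<Longrightarrow>
     (\<forall>i. Suc i < 2^m \<longrightarrow> x i + \<delta> \<le> x (Suc i)) \<Longrightarrow>
     t\<in>{a..b} \<Longrightarrow> \<bar>G 0 t\<bar> \<le> C1 * (\<epsilon> + B * \<delta>^m)"
    using sampling_inequality_1d[of "real (2^m)" m] by (auto simp del: of_nat_power)
  show ?case
  proof (intro exI[of _ "C1 * (C + 1)"] conjI allI impI ballI)
    show "0 \<le> C1 * (C + 1)" using C0 C1 by simp
  next
    fix B k and h :: "real^'d \<Rightarrow> real" and x
    assume h: "Cm_bdd m B cube h" and k: "2^m \<le> k" and z: "\<forall>x\<in>grid k. h x = 0" and x: "x \<in> cube"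
      and xi: "\<forall>j. j \<notin> insert i S \<longrightarrow> (\<exists>l<k. x $ j = real l / real k)"
    have k0: "k > 0" using k by (metis less_le_trans zero_less_numeral zero_less_power)
    \<comment> \<open>First node of a window of \<open>2^m\<close> consecutive cells that contains
      \<open>x $ i\<close>. The cap at \<open>k - 2^m\<close> pushes the window back into
      \<open>{0..1}\<close> near the right end.\<close>
    define i0 where "i0 = min (nat \<lfloor>x $ i * real k\<rfloor>) (k - 2^m)"
    let ?t = "x $ i" and ?a = "real i0 / real k" and ?b = "real (i0 + 2^m) / real k"
    have t01: "0 \<le> ?t" "?t \<le> 1" using x by (auto simp: cube_def)
    have fl: "real (nat \<lfloor>?t * real k\<rfloor>) \<le> ?t * real k" "?t * real k < real (nat \<lfloor>?t * real k\<rfloor>) + 1"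
      using t01 by (auto simp: of_nat_nat)
    have tk: "?t * real k \<le> real k" using t01 by (simp add: mult_left_le_one_le)
    have i0a: "real i0 \<le> ?t * real k" using fl by (auto simp: i0_def)
    have i0b: "?t * real k \<le> real (i0 + 2^m)"
    proof (cases "nat \<lfloor>?t * real k\<rfloor> \<le> k - 2^m")
      case True
      then have "real i0 = real (nat \<lfloor>?t * real k\<rfloor>)" by (simp add: i0_def)
      moreover have "(1::real) \<le> 2^m" by simp
      ultimately show ?thesis using fl(2) unfolding of_nat_add of_nat_power of_nat_numeral by linarith
    next
      case False
      then have "i0 + 2^m = k" using k by (simp add: i0_def)
      then show ?thesis using tk by simp
    qed
    have i0k: "i0 + 2^m \<le> k" using k by (simp add: i0_def)
    have t: "?t \<in> {?a..?b}" using i0a i0b k0 by (simp add: field_simps)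
    have sub: "{?a..?b} \<subseteq> {0..1}"
    proof -
      have "?b \<le> 1" using i0k k0 by (simp del: of_nat_add)
      then show ?thesis by (auto intro: order_trans[rotated])
    qed
    obtain G where G: "G 0 = (\<lambda>t. h (upd_coord x i t))"
      "\<And>l t. l<m \<Longrightarrow> t\<in>{0..1} \<Longrightarrow> (G l has_real_derivative G (Suc l) t) (at t within {0..1})"
      "\<And>t. t\<in>{0..1} \<Longrightarrow> \<bar>G m t\<bar> \<le> B"
      using Cm_bdd_line_derivs[OF h x, of i] by metis
    have "\<bar>G 0 ?t\<bar> \<le> C1 * (C * (B * (1 / real k)^m) + B * (1 / real k) ^ m)"
    proof (rule C1(2)[of "1 / real k" ?b ?a G B "\<lambda>j. real (i0 + j) / real k"])
      show "\<forall>l<m. \<forall>t\<in>{?a..?b}. (G l has_real_derivative G (Suc l) t) (at t within {?a..?b})"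
        using G(2) sub by (blast intro: has_field_derivative_subset)
      show "\<forall>t\<in>{?a..?b}. \<bar>G m t\<bar> \<le> B" using G(3) sub by blast
      show "\<forall>j<2 ^ m. real (i0 + j) / real k \<in> {?a..?b} \<and> \<bar>G 0 (real (i0 + j) / real k)\<bar> \<le> C * (B * (1 / real k) ^ m)"
      proof (intro allI impI conjI)
        fix j :: nat assume j: "j < 2^m"
        show m: "real (i0 + j) / real k \<in> {?a..?b}"
          using j k0 by (simp add: divide_right_mono del: of_nat_add)
        show "\<bar>G 0 (real (i0 + j) / real k)\<bar> \<le> C * (B * (1 / real k) ^ m)"
          unfolding G(1)
        proof (rule C[OF h k z])
          show "upd_coord x i (real (i0 + j) / real k) \<in> cube"
            using upd_coord_in_cube[OF x] m sub by blast
          show "\<forall>ia. ia \<notin> S \<longrightarrow> (\<exists>ja<k. upd_coord x i (real (i0 + j) / real k) $ ia = real ja / real k)"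
            using xi i0k j by (auto simp: upd_coord_nth simp del: of_nat_add intro!: exI[of _ "i0 + j"])
        qed
      qed
    qed (use k0 t in \<open>auto simp: field_simps\<close>)
    then show "\<bar>h x\<bar> \<le> C1 * (C + 1) * (B * (1 / real k) ^ m)"
      by (simp add: G(1) upd_coord_self algebra_simps)
  qed
qed

lemma cube_zero: "0 \<in> cube"
  by (simp add: cube_def)

lemma grid_eq_image: "grid k = (\<lambda>c. \<chi> i. real (c i) / real k) ` (PiE UNIV (\<lambda>_::'d::finite. {..<k}))"
proof (intro subset_antisym subsetI)
  fix x :: "real^'d" assume "x \<in> grid k"
  then have "\<forall>i. \<exists>j. j < k \<and> x $ i = real j / real k" by (simp add: grid_def)
  from choice[OF this] obtain c where "\<And>i. c i < k \<and> x $ i = real (c i) / real k" by blast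
  then show "x \<in> (\<lambda>c. \<chi> i. real (c i) / real k) ` (PiE UNIV (\<lambda>_::'d. {..<k}))"
    by (intro image_eqI[of _ _ c]) (auto simp: vec_eq_iff)
qed (fastforce simp: grid_def PiE_iff simp del: divide_cancel_right)

lemma finite_grid: "finite (grid k :: (real^'d) set)"
  unfolding grid_eq_image by (intro finite_imageI finite_PiE) auto

lemma card_grid_le: "card (grid k :: (real^'d) set) \<le> k ^ CARD('d)"
proof -
  have "card (grid k :: (real^'d) set) \<le> card (PiE UNIV (\<lambda>_::'d. {..<k}))"
    unfolding grid_eq_image by (intro card_image_le finite_PiE) auto
  then show ?thesis by (simp add: card_PiE)
qed

lemma grid_subset_cube: "grid k \<subseteq> (cube :: (real^'d) set)"
proof
  fix x :: "real^'d" assume x: "x \<in> grid k"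
  have "0 \<le> x $ i \<and> x $ i \<le> 1" for i
  proof -
    obtain j where "j < k" "x $ i = real j / real k" using x by (auto simp: grid_def)
    then show ?thesis by simp
  qed
  then show "x \<in> cube" by (simp add: cube_def)
qed

text \<open>The grid with \<open>k = nat \<lfloor>r\<rfloor>\<close>, where \<open>r\<close> is the
  \<open>d\<close>-th root of \<open>n\<close>, has at most \<open>n\<close> points; copies of the
  origin pad the list to length exactly \<open>n\<close>.\<close>

lemma sampling_inequality:
  "\<exists>C>0. \<forall>n\<ge>1. \<exists>xs. length xs = n \<and> set xs \<subseteq> (cube :: (real^'d) set) \<and>
     (\<forall>B h. Cm_bdd m B cube h \<longrightarrow> (\<forall>x\<in>set xs. h x = 0) \<longrightarrow>
        (\<forall>x\<in>cube. \<bar>h x\<bar> \<le> C * (B * real n powr (- (real m / real CARD('d))))))"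
proof -
  let ?d = "real CARD('d)"
  have d0: "?d > 0" by simp
  obtain C where C0: "C \<ge> 0" and C: "\<And>B k (h :: real^'d \<Rightarrow> real) x. Cm_bdd m B cube h \<Longrightarrow> 2^m \<le> k \<Longrightarrow>
     (\<forall>x\<in>grid k. h x = 0) \<Longrightarrow> x\<in>cube \<Longrightarrow> \<bar>h x\<bar> \<le> C * (B * (1 / real k)^m)"
    using grid_sampling_partial[of m "UNIV :: 'd set"] by auto
  show ?thesis
  \<comment> \<open>One summand for each case. If \<open>2^m \<le> k\<close>, rounding costs
    \<open>1 / k \<le> 2 / r\<close>, hence a factor \<open>2^m\<close>. Otherwise
    \<open>r \<le> 2 * 2^m\<close>, so \<open>(2 * 2^m)^m / r^m\<close> is at least 1 and the
    trivial bound by \<open>B\<close> is enough.\<close>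
  proof (intro exI[of _ "C * 2^m + (2 * 2^m)^m"] conjI allI impI)
    show "0 < C * 2^m + (2 * 2^m)^m" using C0 by (intro add_nonneg_pos) auto
  next
    fix n :: nat assume n: "n \<ge> 1"
    define r where "r = real n powr (1 / ?d)"
    have r1: "r \<ge> 1" unfolding r_def using n by (intro ge_one_powr_ge_zero) auto
    have rm: "real n powr (- (real m / ?d)) = (1 / r)^m"
    proof -
      have "(1/r)^m = (real n powr (- (1 / ?d))) powr real m"
        using n by (subst powr_realpow) (auto simp: r_def powr_minus field_simps)
      then show ?thesis by (simp add: powr_powr)
    qed
    define k where "k = nat \<lfloor>r\<rfloor>"
    have k: "real k \<le> r" "r < real k + 1" "real k \<ge> 1"
      using r1 by (auto simp: k_def le_nat_iff le_floor_iff nat_le_real_less)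
    then have "r \<le> 2 * real k" "0 < real k" "0 < r" by linarith+
    then have rk: "1 / real k \<le> 2 * (1 / r)" by (simp add: divide_simps mult.commute)
    have "real (k ^ CARD('d)) \<le> r powr ?d"
      using k r1 by (subst powr_realpow) (auto intro!: power_mono)
    also have "\<dots> = real n" using n by (simp add: r_def powr_powr)
    finally have kn: "k ^ CARD('d) \<le> n" by simp
    obtain ys where ys: "set ys = (grid k :: (real^'d) set)" "length ys = card (grid k :: (real^'d) set)"
      using finite_distinct_list[OF finite_grid] distinct_card by metis
    have ysn: "length ys \<le> n" using ys(2) card_grid_le[of k, where 'd='d] kn by linarith
    let ?xs = "ys @ replicate (n - length ys) 0"
    show "\<exists>xs. length xs = n \<and> set xs \<subseteq> (cube :: (real^'d) set) \<and>
     (\<forall>B h. Cm_bdd m B cube h \<longrightarrow> (\<forall>x\<in>set xs. h x = 0) \<longrightarrow>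
        (\<forall>x\<in>cube. \<bar>h x\<bar> \<le> (C * 2^m + (2 * 2^m)^m) * (B * real n powr (- (real m / ?d)))))"
    proof (intro exI[of _ ?xs] conjI allI impI ballI)
      show "length ?xs = n" using ysn by simp
      show "set ?xs \<subseteq> cube" using ys grid_subset_cube cube_zero by (auto simp: set_replicate_conv_if)
      fix B and h :: "real^'d \<Rightarrow> real" and x :: "real^'d"
      assume h: "Cm_bdd m B cube h" and z: "\<forall>x\<in>set ?xs. h x = 0" and x: "x \<in> cube"
      have hB: "\<bar>h x\<bar> \<le> B" using Cm_bdd_abs_le[OF h x] .
      then have B0: "B \<ge> 0" by linarith
      have "\<bar>h x\<bar> \<le> (C * 2^m + (2 * 2^m)^m) * (B * (1 / r)^m)"
      proof (cases "2^m \<le> k")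
        case True
        have "\<bar>h x\<bar> \<le> C * (B * (1 / real k)^m)"
          by (rule C[OF h True _ x]) (use z ys in auto)
        also have "\<dots> \<le> C * (B * (2 * (1 / r))^m)"
          using rk B0 C0 by (intro mult_left_mono power_mono) auto
        also have "\<dots> = C * 2^m * (B * (1 / r)^m)" by (simp add: power_mult_distrib power_divide)
        also have "\<dots> \<le> (C * 2^m + (2 * 2^m)^m) * (B * (1 / r)^m)"
          using B0 r1 by (intro mult_right_mono) auto
        finally show ?thesis .
      next
        case False
        then have "real k + 1 \<le> 2^m" by (metis Suc_leI add.commute linorder_not_le of_nat_Suc of_nat_le_iff of_nat_numeral of_nat_power)
        then have "r \<le> 2 * 2^m" using k by linarith
        then have "1 \<le> ((2 * 2^m) * (1 / r))^m" using r1 by (intro one_le_power) (auto simp: field_simps)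
        then have "B * 1 \<le> B * ((2 * 2^m) * (1 / r))^m" using B0 by (intro mult_left_mono) auto
        also have "\<dots> = (2 * 2^m)^m * (B * (1 / r)^m)" by (simp add: power_mult_distrib power_divide)
        also have "\<dots> \<le> (C * 2^m + (2 * 2^m)^m) * (B * (1 / r)^m)"
          using B0 C0 r1 by (intro mult_right_mono) auto
        finally show ?thesis using hB by simp
      qed
      then show "\<bar>h x\<bar> \<le> (C * 2^m + (2 * 2^m)^m) * (B * real n powr (- (real m / ?d)))"
        by (simp add: rm)
    qed
  qed
qed

subsection \<open>Fooling functions\<close>

lemma cube_eq_cbox: "cube = cbox 0 (1 :: real^'d)"
  by (auto simp: cube_def mem_box_cart)

lemma compact_cube: "compact (cube :: (real^'d) set)"
  by (simp add: cube_eq_cbox)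

lemma set_integrable_cube:
  fixes f :: "real^'d \<Rightarrow> real"
  shows "continuous_on cube f \<Longrightarrow> set_integrable lborel cube f"
  unfolding set_integrable_def using borel_integrable_compact[OF compact_cube, of f] by simp

section \<open>One-variable bumps with \<open>m\<close> continuous derivatives\<close>

text \<open>Smoothness on the whole line without bounds: bounds follow later from compact support,
  and without them closure under products is a plain induction.\<close>

primrec Ck :: "nat \<Rightarrow> (real \<Rightarrow> real) \<Rightarrow> bool" where
  "Ck 0 f \<longleftrightarrow> continuous_on UNIV f"
| "Ck (Suc k) f \<longleftrightarrow> (\<exists>g. (\<forall>t. (f has_real_derivative g t) (at t)) \<and> Ck k g)"

lemma Ck_continuous_on: "Ck k f \<Longrightarrow> continuous_on UNIV f"
  by (cases k) (auto intro: DERIV_isCont continuous_at_imp_continuous_on)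

lemma Ck_SucD: "Ck (Suc k) f \<Longrightarrow> Ck k f"
proof (induction k arbitrary: f)
  case 0
  then show ?case using Ck_continuous_on by (simp del: Ck.simps(2)) 
next
  case (Suc k)
  then show ?case by (metis Ck.simps(2))
qed

lemma Ck_const: "Ck k (\<lambda>_. c)"
proof (induction k arbitrary: c)
  case (Suc k)
  then show ?case by (auto intro!: exI[of _ "\<lambda>_. 0"])
qed simp

lemma Ck_add: "Ck k f \<Longrightarrow> Ck k g \<Longrightarrow> Ck k (\<lambda>t. f t + g t)"
proof (induction k arbitrary: f g)
  case (Suc k)
  then obtain f' g' where d: "\<And>t. (f has_real_derivative f' t) (at t)" "Ck k f'"
    "\<And>t. (g has_real_derivative g' t) (at t)" "Ck k g'" by auto
  then show ?case
    unfolding Ck.simps using Suc.IH by (intro exI[of _ "\<lambda>t. f' t + g' t"]) (auto intro!: DERIV_add)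
qed (auto intro: continuous_intros)

lemma Ck_mult: "Ck k f \<Longrightarrow> Ck k g \<Longrightarrow> Ck k (\<lambda>t. f t * g t)"
proof (induction k arbitrary: f g)
  case (Suc k)
  then obtain f' g' where d: "\<And>t. (f has_real_derivative f' t) (at t)" "Ck k f'"
    "\<And>t. (g has_real_derivative g' t) (at t)" "Ck k g'" by auto
  have "Ck k (\<lambda>t. f' t * g t + g' t * f t)"
    using Suc Ck_SucD d by (intro Ck_add) blast+
  then show ?case
    unfolding Ck.simps using d(1,3) by (intro exI[of _ "\<lambda>t. f' t * g t + g' t * f t"]) (auto intro!: DERIV_mult)
qed (auto intro: continuous_intros)

lemma Ck_reflect: "Ck k f \<Longrightarrow> Ck k (\<lambda>t. f (1 - t))"
proof (induction k arbitrary: f)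
  case 0
  then show ?case by (auto intro!: continuous_on_compose2[of UNIV f] continuous_intros)
next
  case (Suc k)
  then obtain f' where d: "\<And>t. (f has_real_derivative f' t) (at t)" "Ck k f'" by auto
  have "((\<lambda>t. f (1 - t)) has_real_derivative -1 * f' (1 - t)) (at t)" for t
    by (rule DERIV_chain2[OF d(1), THEN DERIV_cong]) (auto intro!: derivative_eq_intros)
  moreover have "Ck k (\<lambda>t. -1 * f' (1 - t))"
    using Suc.IH[OF d(2)] by (intro Ck_mult Ck_const)
  ultimately show ?case by (auto intro!: exI[of _ "\<lambda>t. -1 * f' (1 - t)"])
qed

text \<open>Away from 0 the function is locally zero or a monomial. At 0 the difference quotient is
  again a truncated power, of positive exponent, and tends to 0.\<close>

lemma DERIV_max_0_power:
  "((\<lambda>t::real. max 0 t ^ Suc (Suc k)) has_real_derivative real (Suc (Suc k)) * max 0 t ^ Suc k) (at t)"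
proof -
  consider "t < 0" | "t > 0" | "t = 0" by linarith
  then show ?thesis
  proof cases
    case 1
    have "((\<lambda>_. 0) has_real_derivative 0) (at t)" by simp
    then have "((\<lambda>t::real. max 0 t ^ Suc (Suc k)) has_real_derivative 0) (at t)"
      by (rule has_field_derivative_transform_within_open[of _ _ _ "{..<0}"]) (use 1 in auto)
    then show ?thesis using 1 by simp
  next
    case 2
    have "((\<lambda>t. t ^ Suc (Suc k)) has_real_derivative real (Suc (Suc k)) * t ^ Suc k) (at t)"
      using DERIV_pow[of "Suc (Suc k)" t] by simp
    then have "((\<lambda>t::real. max 0 t ^ Suc (Suc k)) has_real_derivative real (Suc (Suc k)) * t ^ Suc k) (at t)"
      by (rule has_field_derivative_transform_within_open[of _ _ _ "{0<..}"]) (use 2 in auto)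
    then show ?thesis using 2 by simp
  next
    case 3
    have "((\<lambda>h::real. max 0 h ^ Suc k) \<longlongrightarrow> max 0 0 ^ Suc k) (at 0)"
      by (intro tendsto_intros)
    then have "((\<lambda>h::real. max 0 h ^ Suc k) \<longlongrightarrow> 0) (at 0)" by simp
    then have "((\<lambda>h::real. max 0 h ^ Suc (Suc k) / h) \<longlongrightarrow> 0) (at 0)"
      by (rule Lim_transform_eventually) (auto simp: eventually_at_filter max_def)
    then show ?thesis using 3 by (simp add: DERIV_def)
  qed
qed

text \<open>Only finitely many orders of differentiation ever enter, so truncated powers, glued at
  both ends of an interval, give a sufficient bump.\<close>

lemma Ck_max_0_power: "Ck k (\<lambda>t. max 0 t ^ Suc k)"
proof (induction k)
  case 0
  then show ?case by (auto intro!: continuous_intros)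
next
  case (Suc k)
  have "Ck k (\<lambda>t. real (Suc (Suc k)) * max 0 t ^ Suc k)"
    by (intro Ck_mult Ck_const Suc.IH)
  then show ?case
    unfolding Ck.simps using DERIV_max_0_power
    by (intro exI[of _ "\<lambda>t. real (Suc (Suc k)) * max 0 t ^ Suc k"]) blast
qed

lemma Ck_deriv_seq:
  assumes "Ck m f"
  shows "\<exists>b. b 0 = f \<and> (\<forall>l<m. \<forall>t. (b l has_real_derivative b (Suc l) t) (at t)) \<and>
    (\<forall>l\<le>m. continuous_on UNIV (b l :: real \<Rightarrow> real))"
  using assms
proof (induction m arbitrary: f)
  case 0
  then show ?case by (intro exI[of _ "\<lambda>_. f"]) auto
next
  case (Suc m)
  then obtain g where g: "\<And>t. (f has_real_derivative g t) (at t)" "Ck m g" by auto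
  from Suc.IH[OF g(2)] obtain b where b: "b 0 = g" "\<forall>l<m. \<forall>t. (b l has_real_derivative b (Suc l) t) (at t)"
    "\<forall>l\<le>m. continuous_on UNIV (b l :: real \<Rightarrow> real)" by blast
  show ?case
    using b g(1) Ck_continuous_on[OF Suc.prems]
    by (intro exI[of _ "\<lambda>l. case l of 0 \<Rightarrow> f | Suc l \<Rightarrow> b l"]) (auto split: nat.splits)
qed

text \<open>\<open>b l\<close> is the \<open>l\<close>-th derivative of
  \<open>max 0 t ^ Suc m * max 0 (1 - t) ^ Suc m\<close>. Outside \<open>{0..1}\<close> it vanishes
  because it differentiates a function that is locally zero, and on \<open>{0..1}\<close>
  compactness bounds it. That \<open>b 0\<close> also vanishes at the end points 0 and 1 makes bumps
  in neighbouring cells have disjoint supports of positivity.\<close>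

lemma bump_exists:
  obtains b :: "nat \<Rightarrow> real \<Rightarrow> real" and M \<beta> :: real where
    "M \<ge> 1" "\<beta> > 0"
    "\<And>l t. l < m \<Longrightarrow> (b l has_real_derivative b (Suc l) t) (at t)"
    "\<And>l. l \<le> m \<Longrightarrow> continuous_on UNIV (b l)"
    "\<And>l t. l \<le> m \<Longrightarrow> \<bar>b l t\<bar> \<le> M"
    "\<And>l t. l \<le> m \<Longrightarrow> t \<notin> {0..1} \<Longrightarrow> b l t = 0"
    "\<And>t. b 0 t \<ge> 0" "\<And>t. t \<notin> {0<..<1} \<Longrightarrow> b 0 t = 0" "\<And>t. t \<in> {1/4..3/4} \<Longrightarrow> \<beta> \<le> b 0 t"
proof -
  let ?f = "\<lambda>t::real. max 0 t ^ Suc m * max 0 (1 - t) ^ Suc m"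
  have "Ck m ?f" by (intro Ck_mult Ck_max_0_power Ck_reflect[where f = "\<lambda>t. max 0 t ^ Suc m"])
  from Ck_deriv_seq[OF this] obtain b where b0: "b 0 = ?f"
    and bd: "\<And>l t. l < m \<Longrightarrow> (b l has_real_derivative b (Suc l) t) (at t)"
    and bc: "\<And>l. l \<le> m \<Longrightarrow> continuous_on UNIV (b l :: real \<Rightarrow> real)" by blast
  have out: "b l t = 0" if "l \<le> m" "t \<notin> {0..1}" for l t
    using that
  proof (induction l arbitrary: t)
    case 0
    then show ?case by (auto simp: b0)
  next
    case (Suc l)
    have "((\<lambda>_. 0) has_real_derivative 0) (at t)" by simp
    then have "(b l has_real_derivative 0) (at t)"
      by (rule has_field_derivative_transform_within_open[of _ _ _ "- {0..1}"]) (use Suc in auto)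
    then show ?case using bd[of l t] Suc.prems DERIV_unique by auto
  qed
  have "\<exists>M. \<forall>t. \<bar>b l t\<bar> \<le> M" if l: "l \<le> m" for l
  proof -
    have "bounded (b l ` {0..1})"
      by (intro compact_imp_bounded compact_continuous_image continuous_on_subset[OF bc[OF l]]) auto
    then obtain M where M: "\<forall>y\<in>b l ` {0..1}. norm y \<le> M" unfolding bounded_iff by blast
    have "\<bar>b l t\<bar> \<le> max 0 M" for t
    proof (cases "t \<in> {0..1}")
      case True
      then have "norm (b l t) \<le> M" using M by blast
      then show ?thesis by simp
    qed (use out[OF l] in auto)
    then show ?thesis by blast
  qed
  then obtain M where M: "\<And>l t. l \<le> m \<Longrightarrow> \<bar>b l t\<bar> \<le> M l" by metis
  show thesis
  \<comment> \<open>On \<open>{1/4..3/4}\<close> both \<open>t\<close> and \<open>1 - t\<close> are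
    at least \<open>1/4\<close>, hence the value of \<open>\<beta>\<close>. The sum turns the bounds
    for the separate orders into a common one.\<close>
  proof (rule that[of "1 + (\<Sum>l\<le>m. \<bar>M l\<bar>)" "(1/4)^Suc m * (1/4)^Suc m" b])
    fix l t assume l: "l \<le> m"
    have "\<bar>b l t\<bar> \<le> \<bar>M l\<bar>" using M[OF l, of t] by linarith
    also have "\<dots> \<le> (\<Sum>l\<le>m. \<bar>M l\<bar>)" using l by (intro member_le_sum) auto
    finally show "\<bar>b l t\<bar> \<le> 1 + (\<Sum>l\<le>m. \<bar>M l\<bar>)" by simp
  next
    fix t :: real assume "t \<in> {1/4..3/4}"
    then show "(1/4)^Suc m * (1/4)^Suc m \<le> b 0 t"
      unfolding b0 by (intro mult_mono power_mono) auto
  qed (use bd bc out in \<open>auto simp: b0 sum_nonneg\<close>)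
qed

section \<open>Tensor products of bumps on the cells of a grid\<close>

text \<open>If \<open>b l\<close> is the \<open>l\<close>-th derivative of \<open>b 0\<close>, this
  is the partial derivative of multi-index \<open>\<alpha>\<close> of the bump rescaled to the cell
  of side \<open>1 / K\<close> with index \<open>c\<close>; the powers of \<open>K\<close> come from
  the chain rule. With \<open>\<alpha>\<close> constantly 0 it is the bump itself.\<close>

definition tensor_bump :: "(nat \<Rightarrow> real \<Rightarrow> real) \<Rightarrow> real \<Rightarrow> ('d::finite \<Rightarrow> nat) \<Rightarrow> ('d \<Rightarrow> nat) \<Rightarrow> real^'d \<Rightarrow> real" where
  "tensor_bump b K \<alpha> c x = (\<Prod>i\<in>UNIV. K ^ \<alpha> i * b (\<alpha> i) (K * x $ i - real (c i)))"

lemma tensor_bump_partial: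
  assumes "\<And>t. (b (\<alpha> i) has_real_derivative b (Suc (\<alpha> i)) t) (at t)"
  shows "has_partial_within X i (tensor_bump b K \<alpha> c) (tensor_bump b K (\<alpha>(i := Suc (\<alpha> i))) c x) x"
proof -
  let ?P = "\<Prod>j\<in>UNIV - {i}. K ^ \<alpha> j * b (\<alpha> j) (K * x $ j - real (c j))"
  have 1: "tensor_bump b K \<alpha> c (x + t *\<^sub>R axis i 1) = K ^ \<alpha> i * b (\<alpha> i) (K * (x $ i + t) - real (c i)) * ?P" for t
    unfolding tensor_bump_def by (subst prod.remove[of _ i]) (auto simp: axis_def intro!: prod.cong)
  have 2: "tensor_bump b K (\<alpha>(i := Suc (\<alpha> i))) c x = K ^ \<alpha> i * (b (Suc (\<alpha> i)) (K * x $ i - real (c i)) * K) * ?P"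
    unfolding tensor_bump_def by (subst prod.remove[of _ i]) (auto simp: axis_def intro!: prod.cong)
  have "((\<lambda>t. b (\<alpha> i) (K * (x $ i + t) - real (c i))) has_real_derivative
      b (Suc (\<alpha> i)) (K * (x $ i + 0) - real (c i)) * K) (at 0)"
    by (rule DERIV_chain2[OF assms]) (auto intro!: derivative_eq_intros)
  then have "((\<lambda>t. K ^ \<alpha> i * b (\<alpha> i) (K * (x $ i + t) - real (c i)) * ?P) has_real_derivative
      K ^ \<alpha> i * (b (Suc (\<alpha> i)) (K * (x $ i + 0) - real (c i)) * K) * ?P) (at 0)"
    by (intro DERIV_cmult DERIV_cmult_right)
  then show ?thesis
    unfolding has_partial_within_def 1 2 by (auto intro: has_field_derivative_at_within)
qed

lemma continuous_on_tensor_bump: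
  assumes "\<And>i. continuous_on UNIV (b (\<alpha> i))"
  shows "continuous_on X (tensor_bump b K \<alpha> c)"
proof -
  have "continuous_on X (\<lambda>x. b (\<alpha> i) (K * x $ i - real (c i)))" for i
    by (rule continuous_on_compose2[OF assms]) (auto intro!: continuous_intros)
  then show ?thesis unfolding tensor_bump_def by (intro continuous_on_prod continuous_on_mult_left)
qed

text \<open>A point lies in at most two of the closed unit intervals that start at the integers, two
  if it is a common end point. The bound is therefore independent of the number of
  translates.\<close>

lemma sum_translates_le:
  fixes b :: "real \<Rightarrow> real"
  assumes "\<And>t. \<bar>b t\<bar> \<le> M" "\<And>t. t \<notin> {0..1} \<Longrightarrow> b t = 0"
  shows "(\<Sum>j<K. \<bar>b (s - real j)\<bar>) \<le> 2 * M"
proof -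
  have M0: "M \<ge> 0" using assms(1)[of 0] by linarith
  let ?J = "{nat \<lfloor>s\<rfloor>, nat \<lfloor>s\<rfloor> - 1}"
  have "(\<Sum>j<K. \<bar>b (s - real j)\<bar>) = (\<Sum>j\<in>{..<K} \<inter> ?J. \<bar>b (s - real j)\<bar>)"
  proof (rule sum.mono_neutral_right)
    show "\<forall>i\<in>{..<K} - {..<K} \<inter> ?J. \<bar>b (s - real i)\<bar> = 0"
    proof
      fix i assume "i \<in> {..<K} - {..<K} \<inter> ?J"
      then have "i \<noteq> nat \<lfloor>s\<rfloor>" "i \<noteq> nat \<lfloor>s\<rfloor> - 1" by auto
      then have "s - real i \<notin> {0..1}" by (auto simp: le_floor_iff nat_eq_iff) linarith+
      then show "\<bar>b (s - real i)\<bar> = 0" using assms(2) by simp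
    qed
  qed auto
  also have "\<dots> \<le> (\<Sum>j\<in>{..<K} \<inter> ?J. M)" by (intro sum_mono assms)
  also have "\<dots> = real (card ({..<K} \<inter> ?J)) * M" by simp
  also have "\<dots> \<le> 2 * M"
  proof -
    have "card ({..<K} \<inter> ?J) \<le> card ?J" by (intro card_mono) auto
    also have "\<dots> \<le> 2" by (simp add: card_insert_if)
    finally have "real (card ({..<K} \<inter> ?J)) \<le> 2" by simp
    then show ?thesis using M0 by (intro mult_right_mono) auto
  qed
  finally show ?thesis .
qed

text \<open>After enlarging \<open>T\<close> to the full box of indices, the sum of absolute values
  factorises into one-dimensional sums over translates, each at most \<open>2 * M\<close>. The
  number of bumps disappears from the bound, and \<open>K ^ m\<close> is the price of at most
  \<open>m\<close> derivatives.\<close>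

lemma sum_tensor_bump_le:
  fixes T :: "('d::finite \<Rightarrow> nat) set"
  assumes "\<And>l t. l \<le> m \<Longrightarrow> \<bar>b l t\<bar> \<le> M" "\<And>l t. l \<le> m \<Longrightarrow> t \<notin> {0..1} \<Longrightarrow> b l t = 0"
    and T: "T \<subseteq> PiE UNIV (\<lambda>_. {..<K})" and \<alpha>: "sum \<alpha> UNIV \<le> m" and K: "K \<ge> 1"
  shows "\<bar>\<Sum>c\<in>T. tensor_bump b (real K) \<alpha> c x\<bar> \<le> real K ^ m * (2 * M) ^ CARD('d)"
proof -
  have \<alpha>i: "\<alpha> i \<le> m" for i using \<alpha> member_le_sum[of i UNIV \<alpha>] by auto
  have M0: "M \<ge> 0" using assms(1)[of 0 0] by linarith
  have eq: "\<bar>tensor_bump b (real K) \<alpha> c x\<bar> = real K ^ sum \<alpha> UNIV * (\<Prod>i\<in>UNIV. \<bar>b (\<alpha> i) (real K * x $ i - real (c i))\<bar>)" for c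
    by (simp add: tensor_bump_def abs_prod abs_mult prod.distrib power_sum)
  have "\<bar>\<Sum>c\<in>T. tensor_bump b (real K) \<alpha> c x\<bar> \<le> (\<Sum>c\<in>T. \<bar>tensor_bump b (real K) \<alpha> c x\<bar>)"
    by (rule sum_abs)
  also have "\<dots> \<le> (\<Sum>c\<in>PiE UNIV (\<lambda>_. {..<K}). \<bar>tensor_bump b (real K) \<alpha> c x\<bar>)"
    using T by (intro sum_mono2 finite_PiE) auto
  also have "\<dots> = real K ^ sum \<alpha> UNIV * (\<Prod>i\<in>UNIV. \<Sum>j<K. \<bar>b (\<alpha> i) (real K * x $ i - real j)\<bar>)"
    unfolding eq sum_distrib_left[symmetric] by (subst prod_sum_PiE) auto
  also have "\<dots> \<le> real K ^ m * (\<Prod>i\<in>(UNIV::'d set). 2 * M)"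
    using \<alpha> K M0 assms(1,2) \<alpha>i
    by (intro mult_mono power_increasing prod_mono conjI sum_translates_le sum_nonneg prod_nonneg) auto
  finally show ?thesis by simp
qed

lemma has_partial_sum:
  "(\<And>c. c \<in> T \<Longrightarrow> has_partial_within X i (f c) (D c) x) \<Longrightarrow>
   has_partial_within X i (\<lambda>x. H * (\<Sum>c\<in>T. f c x)) (H * (\<Sum>c\<in>T. D c)) x"
  unfolding has_partial_within_def by (intro DERIV_cmult DERIV_sum)

text \<open>The multi-index is generalised for the induction: differentiating in direction
  \<open>i\<close> raises \<open>\<alpha> i\<close> by one while \<open>k\<close> drops by one. The
  case of interest is \<open>k = m\<close> with \<open>\<alpha>\<close> zero.\<close>

lemma Cm_bdd_sum_tensor_bump:
  fixes T :: "('d::finite \<Rightarrow> nat) set"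
  assumes b: "\<And>l t. l < m \<Longrightarrow> (b l has_real_derivative b (Suc l) t) (at t)"
    "\<And>l. l \<le> m \<Longrightarrow> continuous_on UNIV (b l)"
    "\<And>l t. l \<le> m \<Longrightarrow> \<bar>b l t\<bar> \<le> M" "\<And>l t. l \<le> m \<Longrightarrow> t \<notin> {0..1} \<Longrightarrow> b l t = 0"
    and T: "T \<subseteq> PiE UNIV (\<lambda>_. {..<K})" and K: "K \<ge> 1"
    and H: "H \<ge> 0" "H * (real K ^ m * (2 * M) ^ CARD('d)) \<le> B"
  shows "k + sum \<alpha> UNIV \<le> m \<Longrightarrow> Cm_bdd k B X (\<lambda>x. H * (\<Sum>c\<in>T. tensor_bump b (real K) \<alpha> c x))"
proof (induction k arbitrary: \<alpha>)
  case base: 0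
  have \<alpha>i: "\<alpha> i \<le> m" for i using base member_le_sum[of i UNIV \<alpha>] by auto
  have "\<bar>H * (\<Sum>c\<in>T. tensor_bump b (real K) \<alpha> c x)\<bar> \<le> B" for x
  proof -
    have "\<bar>H * (\<Sum>c\<in>T. tensor_bump b (real K) \<alpha> c x)\<bar> = H * \<bar>\<Sum>c\<in>T. tensor_bump b (real K) \<alpha> c x\<bar>"
      using H(1) by (simp add: abs_mult)
    also have "\<dots> \<le> H * (real K ^ m * (2 * M) ^ CARD('d))"
      using H(1) base by (intro mult_left_mono sum_tensor_bump_le b T K) auto
    finally show ?thesis using H(2) by linarith
  qed
  then show ?case
    using b(2)[OF \<alpha>i] by (auto intro!: continuous_intros continuous_on_tensor_bump)
next
  case (Suc k)
  have "Cm_bdd k B X (\<lambda>x. H * (\<Sum>c\<in>T. tensor_bump b (real K) \<alpha> c x))"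
    using Suc by auto
  moreover have "\<exists>g. (\<forall>x\<in>X. has_partial_within X i (\<lambda>x. H * (\<Sum>c\<in>T. tensor_bump b (real K) \<alpha> c x)) (g x) x) \<and> Cm_bdd k B X g" for i
  proof (intro exI conjI ballI)
    have "\<alpha> i \<le> sum \<alpha> UNIV" by (intro member_le_sum) auto
    then have i: "\<alpha> i < m" using Suc.prems by linarith
    show "has_partial_within X i (\<lambda>x. H * (\<Sum>c\<in>T. tensor_bump b (real K) \<alpha> c x))
       (H * (\<Sum>c\<in>T. tensor_bump b (real K) (\<alpha>(i := Suc (\<alpha> i))) c x)) x" for x
      using b(1)[OF i] by (intro has_partial_sum tensor_bump_partial) auto
    have "sum (\<alpha>(i := Suc (\<alpha> i))) UNIV = Suc (sum \<alpha> UNIV)"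
      by (simp add: sum.remove[of UNIV i])
    then show "Cm_bdd k B X (\<lambda>x. H * (\<Sum>c\<in>T. tensor_bump b (real K) (\<alpha>(i := Suc (\<alpha> i))) c x))"
      using Suc.prems by (intro Suc.IH) auto
  qed
  ultimately show ?case by (auto dest: Cm_bdd_abs_le Cm_bdd_continuous_on)
qed

text \<open>On the concentric box of half the side of the cell, volume
  \<open>(1 / (2 * K)) ^ CARD('d)\<close>, each factor is at least \<open>\<beta>\<close>; elsewhere
  the bump is nonnegative.\<close>

lemma set_integral_tensor_bump_ge:
  fixes c :: "'d::finite \<Rightarrow> nat"
  assumes b: "continuous_on UNIV (b 0)" "\<And>t. b 0 t \<ge> 0" "\<And>t. t \<in> {1/4..3/4} \<Longrightarrow> \<beta> \<le> b 0 t" "\<beta> > 0"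
    and c: "\<And>i. c i < K"
  shows "(\<beta> / (2 * real K)) ^ CARD('d) \<le> (LINT x:cube|lborel. tensor_bump b (real K) (\<lambda>_. 0) c x)"
proof -
  have K: "K > 0" using c[of undefined] by simp
  let ?l = "(\<chi> i. (real (c i) + 1/4) / real K) :: real^'d" and ?u = "(\<chi> i. (real (c i) + 3/4) / real K) :: real^'d"
  let ?E = "cbox ?l ?u"
  have E: "0 \<le> x $ i \<and> x $ i \<le> 1 \<and> real K * x $ i - real (c i) \<in> {1/4..3/4}" if "x \<in> ?E" for x i
  proof -
    have "(real (c i) + 1/4) / real K \<le> x $ i" "x $ i \<le> (real (c i) + 3/4) / real K"
      using that by (auto simp: mem_box_cart)
    then have 1: "real (c i) + 1/4 \<le> real K * x $ i" "real K * x $ i \<le> real (c i) + 3/4"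
      using K by (simp_all add: field_simps)
    have "real (c i) + 1 \<le> real K" using c[of i] by linarith
    then have "real K * x $ i \<le> real K * 1" "real K * 0 \<le> real K * x $ i" using 1 by linarith+
    then have "x $ i \<le> 1" "0 \<le> x $ i" using K by (auto simp only: mult_le_cancel_left_pos of_nat_0_less_iff)
    then show ?thesis using 1 by simp
  qed
  have EC: "?E \<subseteq> cube" using E by (auto simp: cube_def)
  have "measure lborel ?E = (\<Prod>i\<in>UNIV. ?u $ i - ?l $ i)"
    by (subst content_cbox_cart) (auto simp: interval_ne_empty_cart divide_right_mono)
  also have "\<dots> = (\<Prod>i\<in>(UNIV::'d set). 1 / (2 * real K))"
    using K by (intro prod.cong) (auto simp: field_simps)
  finally have cont: "measure lborel ?E = (1 / (2 * real K)) ^ CARD('d)" by simp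
  have "(\<beta> / (2 * real K)) ^ CARD('d) = \<beta> ^ CARD('d) * measure lborel ?E"
    by (simp add: cont power_divide)
  also have "\<dots> = (LINT x|lborel. \<beta> ^ CARD('d) * indicator ?E x)" by simp
  also have "\<dots> \<le> (LINT x|lborel. indicator cube x *\<^sub>R tensor_bump b (real K) (\<lambda>_. 0) c x)"
  proof (rule integral_mono)
    show "integrable lborel (\<lambda>x. \<beta> ^ CARD('d) * indicator ?E x :: real)"
      by (intro integrable_mult_right) (auto simp: integrable_indicator_iff emeasure_lborel_cbox_eq)
    show "integrable lborel (\<lambda>x. indicator cube x *\<^sub>R tensor_bump b (real K) (\<lambda>_. 0) c x)"
      using set_integrable_cube[OF continuous_on_tensor_bump[of b "\<lambda>_. 0" cube "real K" c]] b(1)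
      unfolding set_integrable_def by simp
    fix x :: "real^'d"
    have nn: "tensor_bump b (real K) (\<lambda>_. 0) c x \<ge> 0"
      unfolding tensor_bump_def using b(2) by (intro prod_nonneg) auto
    show "\<beta> ^ CARD('d) * indicator ?E x \<le> indicator cube x *\<^sub>R tensor_bump b (real K) (\<lambda>_. 0) c x"
    proof (cases "x \<in> ?E")
      case True
      have "(\<Prod>i\<in>(UNIV::'d set). \<beta>) \<le> (\<Prod>i\<in>UNIV. real K ^ 0 * b 0 (real K * x $ i - real (c i)))"
        using E[OF True] b by (intro prod_mono) auto
      then have "\<beta> ^ CARD('d) \<le> tensor_bump b (real K) (\<lambda>_. 0) c x" by (simp add: tensor_bump_def)
      then show ?thesis using True EC by (auto simp: indicator_def)
    qed (use nn in \<open>auto simp: indicator_def\<close>)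
  qed
  finally show ?thesis by (simp add: set_lebesgue_integral_def)
qed

text \<open>The half cube has \<open>K ^ d / 2\<close> cells and \<open>K ^ d \<ge> 4 * n\<close>.
  Each query point spoils at most one cell, so at least \<open>K ^ d / 4\<close> bumps survive.
  Their number cancels the cell volume in each single integral, and the total is of the order of the
  common height.\<close>

lemma fooling_function:
  fixes i0 :: "'d::finite"
  shows "\<exists>\<eta>>0. \<forall>B>0. \<forall>n\<ge>1. \<forall>pts :: (real^'d) set. finite pts \<longrightarrow> card pts \<le> n \<longrightarrow>
    (\<exists>f. Cm_bdd m B cube f \<and> (\<forall>p\<in>pts. f p = 0) \<and> (\<forall>x. x $ i0 > 1/2 \<longrightarrow> f x = 0) \<and>
       \<eta> * (B * real n powr (- (real m / real CARD('d)))) \<le> (LINT x:cube|lborel. f x))"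
proof -
  let ?D = "CARD('d)"
  obtain b :: "nat \<Rightarrow> real \<Rightarrow> real" and M \<beta> :: real where M: "M \<ge> 1" and \<beta>: "\<beta> > 0"
    and b: "\<And>l t. l < m \<Longrightarrow> (b l has_real_derivative b (Suc l) t) (at t)"
    "\<And>l. l \<le> m \<Longrightarrow> continuous_on UNIV (b l)"
    "\<And>l t. l \<le> m \<Longrightarrow> \<bar>b l t\<bar> \<le> M"
    "\<And>l t. l \<le> m \<Longrightarrow> t \<notin> {0..1} \<Longrightarrow> b l t = 0"
    and b0: "\<And>t. b 0 t \<ge> 0" "\<And>t. t \<notin> {0<..<1} \<Longrightarrow> b 0 t = 0" "\<And>t. t \<in> {1/4..3/4} \<Longrightarrow> \<beta> \<le> b 0 t"
    by (rule bump_exists[of m]) blast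
  \<comment> \<open>The factor 4 is the surviving quarter of the cells, \<open>\<beta> / 2\<close>
    per coordinate comes from the integral of one bump, and the rest is the height with
    \<open>K \<le> 8 * r\<close>.\<close>
  define \<eta> where "\<eta> = \<beta> ^ ?D / (4 * 2 ^ ?D * (8 ^ m * (2 * M) ^ ?D))"
  show ?thesis
  proof (intro exI[of _ \<eta>] conjI allI impI)
    show "\<eta> > 0" unfolding \<eta>_def using M \<beta> by simp
  next
    fix B :: real and n :: nat and pts :: "(real^'d) set"
    assume B: "B > 0" and n: "n \<ge> 1" and pts: "finite pts" "card pts \<le> n"
    define r where "r = real n powr (1 / real ?D)"
    have r1: "r \<ge> 1" unfolding r_def using n by (intro ge_one_powr_ge_zero) auto
    have rm: "real n powr (- (real m / real ?D)) = 1 / r^m"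
    proof -
      have "(1/r)^m = (real n powr (- (1 / real ?D))) powr real m"
        using n by (subst powr_realpow) (auto simp: r_def powr_minus field_simps)
      then show ?thesis by (simp add: powr_powr power_divide)
    qed
    \<comment> \<open>\<open>K\<close> is even, so the hyperplane where coordinate \<open>i0\<close>
      equals \<open>1/2\<close> is a cell boundary, and \<open>k\<close> counts the layers of cells
      up to it. Since \<open>r \<ge> 1\<close>, rounding up keeps \<open>K\<close> between
      \<open>4 * r\<close> and \<open>8 * r\<close>.\<close>
    define k where "k = 2 * nat \<lceil>r\<rceil>"
    define K where "K = 2 * k"
    have rc: "r \<le> real (nat \<lceil>r\<rceil>)" "real (nat \<lceil>r\<rceil>) \<le> r + 1" using r1 by (auto simp: of_nat_nat)
    have K: "4 * r \<le> real K" "real K \<le> 8 * r" using rc r1 unfolding K_def k_def of_nat_mult of_nat_numeral by linarith+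
    have K0: "real K > 0" "K \<ge> 1" using K(1) r1 by (linarith, cases K) auto
    have Kn: "4 * real n \<le> real K ^ ?D"
    proof -
      have "4 * real n \<le> 4 ^ ?D * real n" using self_le_power[of "4::real" ?D] by (intro mult_right_mono) auto
      also have "\<dots> = (4 * r) ^ ?D"
        using n by (simp add: power_mult_distrib r_def powr_realpow[symmetric] powr_powr)
      also have "\<dots> \<le> real K ^ ?D" using K r1 by (intro power_mono) auto
      finally show ?thesis .
    qed
    \<comment> \<open>A bump is nonzero at \<open>p\<close> only if every
      \<open>K * p $ i - c i\<close> lies strictly between 0 and 1, which forces
      \<open>c = cell p\<close>. Points on cell boundaries are thus zeros of all bumps.\<close>
    define cell :: "real^'d \<Rightarrow> 'd \<Rightarrow> nat" where "cell = (\<lambda>p i. nat \<lfloor>real K * p $ i\<rfloor>)"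
    define U where "U = PiE UNIV (\<lambda>i::'d. if i = i0 then {..<k} else {..<K})"
    define T where "T = U - cell ` pts"
    have finU: "finite U" unfolding U_def by (intro finite_PiE) auto
    have "card U = (\<Prod>i\<in>(UNIV::'d set). if i = i0 then k else K)"
      unfolding U_def by (subst card_PiE) (auto intro!: prod.cong)
    also have "\<dots> = k * K ^ (?D - 1)"
      by (subst prod.remove[of _ i0]) auto
    finally have cardU: "2 * card U = K ^ ?D"
      by (simp add: K_def power_eq_if[of _ ?D])
    have cardT: "real K ^ ?D / 4 \<le> real (card T)"
    proof -
      have "card U \<le> card T + card (cell ` pts)"
        unfolding T_def using diff_card_le_card_Diff[of "cell ` pts" U] pts by (simp add: le_diff_conv)
      also have "\<dots> \<le> card T + n" using card_image_le[OF pts(1), of cell] pts(2) by simp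
      finally have "real (card U) \<le> real (card T) + real n" by linarith
      moreover have "2 * real (card U) = real K ^ ?D" using cardU by (metis of_nat_mult of_nat_numeral of_nat_power)
      ultimately show ?thesis using Kn by linarith
    qed
    have TK: "T \<subseteq> PiE UNIV (\<lambda>_. {..<K})"
    proof
      fix c assume "c \<in> T"
      then have "\<And>i. c i \<in> (if i = i0 then {..<k} else {..<K})" by (auto simp: T_def U_def PiE_iff)
      then have "\<And>i. c i < K" by (metis K_def lessThan_iff less_le_trans mult_2 le_add1)
      then show "c \<in> PiE UNIV (\<lambda>_. {..<K})" by auto
    qed
    \<comment> \<open>The largest height for which the norm estimate for sums of bumps yields
      \<open>B\<close>.\<close>
    define H where "H = B / (real K ^ m * (2 * M) ^ ?D)"
    have H0: "H > 0" unfolding H_def using B K0 M by simp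
    define f where "f = (\<lambda>x. H * (\<Sum>c\<in>T. tensor_bump b (real K) (\<lambda>_. 0) c x))"
    show "\<exists>f. Cm_bdd m B cube f \<and> (\<forall>p\<in>pts. f p = 0) \<and> (\<forall>x. x $ i0 > 1/2 \<longrightarrow> f x = 0) \<and>
       \<eta> * (B * real n powr (- (real m / real ?D))) \<le> (LINT x:cube|lborel. f x)"
    proof (intro exI[of _ f] conjI ballI allI impI)
      show "Cm_bdd m B cube f"
        unfolding f_def using H0 K0 M
        by (intro Cm_bdd_sum_tensor_bump[of m b M T K] b TK) (auto simp: H_def)
    next
      fix p assume p: "p \<in> pts"
      have "tensor_bump b (real K) (\<lambda>_. 0) c p = 0" if c: "c \<in> T" for c
      proof (rule ccontr)
        assume "tensor_bump b (real K) (\<lambda>_. 0) c p \<noteq> 0"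
        then have "\<And>i. b 0 (real K * p $ i - real (c i)) \<noteq> 0" by (simp add: tensor_bump_def)
        then have "\<And>i. real K * p $ i - real (c i) \<in> {0<..<1}" using b0(2) by blast
        then have "\<And>i. \<lfloor>real K * p $ i\<rfloor> = int (c i)" by (simp add: floor_eq_iff) (smt (verit))
        then have "c = cell p" by (auto simp: cell_def)
        then show False using c p by (auto simp: T_def)
      qed
      then show "f p = 0" by (simp add: f_def)
    next
      fix x :: "real^'d" assume x: "x $ i0 > 1/2"
      have "tensor_bump b (real K) (\<lambda>_. 0) c x = 0" if c: "c \<in> T" for c
      proof -
        have "c i0 < k" using c by (auto simp: T_def U_def PiE_iff dest!: spec[of _ i0])
        then have "real (c i0) + 1 \<le> real k" by linarith
        moreover have "real K * (1/2) \<le> real K * x $ i0" using x by (intro mult_left_mono) auto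
        moreover have "real K * (1/2) = real k" by (simp add: K_def)
        ultimately have "1 \<le> real K * x $ i0 - real (c i0)" by linarith
        then have "b 0 (real K * x $ i0 - real (c i0)) = 0" using b0(2) by simp
        then show ?thesis by (auto simp: tensor_bump_def)
      qed
      then show "f x = 0" by (simp add: f_def)
    next
      have "\<eta> * (B * real n powr (- (real m / real ?D))) = (B / ((8 * r) ^ m * (2 * M) ^ ?D)) * (\<beta> ^ ?D / (4 * 2 ^ ?D))"
        unfolding rm \<eta>_def by (simp add: power_mult_distrib mult_ac)
      also have "\<dots> \<le> H * (\<beta> ^ ?D / (4 * 2 ^ ?D))"
        unfolding H_def using B M \<beta> K r1 K0
        by (intro mult_right_mono divide_left_mono mult_pos_pos power_mono) auto
      also have "\<dots> = H * (real K ^ ?D / 4 * (\<beta> / (2 * real K)) ^ ?D)"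
        using K0 by (simp add: power_divide power_mult_distrib)
      also have "\<dots> \<le> H * (real (card T) * (\<beta> / (2 * real K)) ^ ?D)"
        using H0 \<beta> cardT by (intro mult_left_mono mult_right_mono) auto
      also have "\<dots> = H * (\<Sum>c\<in>T. (\<beta> / (2 * real K)) ^ ?D)" by simp
      also have "\<dots> \<le> H * (\<Sum>c\<in>T. LINT x:cube|lborel. tensor_bump b (real K) (\<lambda>_. 0) c x)"
      proof (intro mult_left_mono sum_mono set_integral_tensor_bump_ge b0 \<beta>)
        fix c i assume "c \<in> T"
        then show "c i < K" using TK by (auto simp: PiE_iff)
      qed (use H0 b(2) in auto)
      also have "\<dots> = (LINT x:cube|lborel. f x)"
      proof -
        have "set_integrable lborel cube (\<lambda>x. tensor_bump b (real K) (\<lambda>_. 0) c x)" for c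
          using set_integrable_cube[OF continuous_on_tensor_bump[of b "\<lambda>_. 0" cube "real K" c]] b(2) by simp
        then show ?thesis
          unfolding f_def set_lebesgue_integral_def set_integrable_def
          by (subst Bochner_Integration.integral_sum[symmetric])
             (auto simp: sum_distrib_left sum_distrib_right mult_ac simp flip: integral_mult_right_zero)
      qed
      finally show "\<eta> * (B * real n powr (- (real m / real ?D))) \<le> (LINT x:cube|lborel. f x)" .
    qed
  qed
qed

subsection \<open>Stability under uniform perturbations\<close>

lemma measure_lborel_cube: "measure lborel (cube :: (real^'d) set) = 1"
proof -
  have "measure lborel (cbox 0 (1 :: real^'d)) = (\<Prod>i\<in>UNIV. (1 :: real^'d) $ i - 0 $ i)"
    by (rule content_cbox_cart) (simp add: interval_ne_empty_cart)
  then show ?thesis by (simp add: cube_eq_cbox)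
qed

lemma cube_borel [measurable]: "cube \<in> sets borel"
  by (simp add: cube_eq_cbox)

lemma Zf_const: "Zf (\<lambda>_ :: real^'d. c) = exp c"
  by (simp add: Zf_def set_lebesgue_integral_def measure_lborel_cube)

lemma set_integrable_exp: "continuous_on cube f \<Longrightarrow> set_integrable lborel cube (\<lambda>x. exp (f x :: real))"
  by (intro set_integrable_cube continuous_intros)

lemma Zf_le:
  assumes "continuous_on cube f" "continuous_on cube g" "\<And>x. x \<in> cube \<Longrightarrow> f x \<le> g x + \<delta>"
  shows "Zf f \<le> exp \<delta> * Zf g"
proof -
  have "Zf f \<le> (LINT x:cube|lborel. exp \<delta> * exp (g x))"
    unfolding Zf_def using assms(3)
    by (intro set_integral_mono set_integrable_exp assms set_integrable_mult_right)
       (auto simp flip: exp_add simp: add.commute)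
  then show ?thesis by (simp add: Zf_def)
qed

lemma Zf_pos:
  fixes f :: "real^'d \<Rightarrow> real"
  assumes f: "continuous_on cube f"
  shows "0 < Zf f"
proof -
  have "bounded (f ` cube)" using f compact_cube by (intro compact_imp_bounded compact_continuous_image)
  then obtain c where "\<forall>y\<in>f ` cube. norm y \<le> c" unfolding bounded_iff by blast
  then have "- c \<le> f x + 0" if "x \<in> cube" for x using that by force
  then have "Zf (\<lambda>_::real^'d. - c) \<le> exp 0 * Zf f"
    using Zf_le[OF continuous_on_const f] by blast
  then have "exp (- c) \<le> Zf f" by (simp only: Zf_const exp_zero mult_1)
  then show ?thesis using exp_gt_zero[of "- c"] by linarith
qed

lemma Lf_le:
  assumes "continuous_on cube f" "continuous_on cube g" "\<And>x. x \<in> cube \<Longrightarrow> \<bar>f x - g x\<bar> \<le> \<delta>"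
  shows "Lf f \<le> Lf g + \<delta>"
proof -
  have "f x \<le> g x + \<delta>" if "x \<in> cube" for x using assms(3)[OF that] by linarith
  then have "Zf f \<le> exp \<delta> * Zf g" by (intro Zf_le assms(1,2))
  then have "ln (Zf f) \<le> ln (exp \<delta> * Zf g)"
    using Zf_pos[OF assms(1)] Zf_pos[OF assms(2)] by (subst ln_le_cancel_iff) auto
  then show ?thesis using Zf_pos[OF assms(2)] by (simp add: Lf_def ln_mult)
qed

lemma Lf_diff_le:
  assumes "continuous_on cube f" "continuous_on cube g" "\<And>x. x \<in> cube \<Longrightarrow> \<bar>f x - g x\<bar> \<le> \<delta>"
  shows "\<bar>Lf f - Lf g\<bar> \<le> \<delta>"
proof -
  have "\<And>x. x \<in> cube \<Longrightarrow> \<bar>g x - f x\<bar> \<le> \<delta>" using assms(3) by (simp add: abs_minus_commute)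
  then show ?thesis using Lf_le[OF assms] Lf_le[OF assms(2,1)] by force
qed

section \<open>Gibbs densities\<close>

text \<open>Kept general because it serves both \<open>pdf f\<close> and the normalised remainder
  density in the Wasserstein estimate.\<close>

lemma
  fixes \<rho> :: "real^'d \<Rightarrow> real"
  assumes \<rho>: "integrable lborel \<rho>" "\<And>x. 0 \<le> \<rho> x" "integral\<^sup>L lborel \<rho> = 1" "\<And>x. x \<notin> cube \<Longrightarrow> \<rho> x = 0"
  shows density_in_Dists: "density lborel (\<lambda>x. ennreal (\<rho> x)) \<in> Dists"
    and measure_density_lborel: "A \<in> sets borel \<Longrightarrow>
      measure (density lborel (\<lambda>x. ennreal (\<rho> x))) A = (LINT x|lborel. \<rho> x * indicator A x)"
proof -
  have m [measurable]: "\<rho> \<in> borel_measurable borel"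
    using borel_measurable_integrable[OF \<rho>(1)] by simp
  have em: "emeasure (density lborel (\<lambda>x. ennreal (\<rho> x))) A = ennreal (LINT x|lborel. \<rho> x * indicator A x)"
    if A [measurable]: "A \<in> sets borel" for A
  proof -
    have "emeasure (density lborel (\<lambda>x. ennreal (\<rho> x))) A = (\<integral>\<^sup>+x. ennreal (\<rho> x * indicator A x) \<partial>lborel)"
      by (subst emeasure_density) (auto intro!: nn_integral_cong simp: indicator_def)
    also have "\<dots> = ennreal (LINT x|lborel. \<rho> x * indicator A x)"
      using \<rho>(2) integrable_mult_indicator[of A lborel \<rho>] \<rho>(1)
      by (intro nn_integral_eq_integral) (auto simp: mult.commute)
    finally show ?thesis .
  qed
  show "measure (density lborel (\<lambda>x. ennreal (\<rho> x))) A = (LINT x|lborel. \<rho> x * indicator A x)" if "A \<in> sets borel"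
    unfolding measure_def em[OF that] by (intro enn2real_ennreal Bochner_Integration.integral_nonneg) (auto simp: \<rho>(2))
  have "(\<lambda>x. \<rho> x * indicator cube x) = \<rho>" using \<rho>(4) by (auto simp: indicator_def fun_eq_iff)
  then have "emeasure (density lborel (\<lambda>x. ennreal (\<rho> x))) cube = 1" using em[of cube] \<rho>(3) by simp
  moreover have "emeasure (density lborel (\<lambda>x. ennreal (\<rho> x))) UNIV = 1" using em[of UNIV] \<rho>(3) by simp
  ultimately show "density lborel (\<lambda>x. ennreal (\<rho> x)) \<in> Dists"
    by (auto simp: Dists_def intro!: prob_spaceI)
qed

definition pdf :: "(real^'d \<Rightarrow> real) \<Rightarrow> real^'d \<Rightarrow> real" where
  "pdf f x = indicator cube x * exp (f x) / Zf f"

lemma Pf_eq_density: "Pf f = density lborel (\<lambda>x. ennreal (pdf f x))"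
  by (simp add: Pf_def pdf_def)

lemma pdf_outside: "x \<notin> cube \<Longrightarrow> pdf f x = 0"
  by (simp add: pdf_def)

lemma pdf_pos: "continuous_on cube f \<Longrightarrow> x \<in> cube \<Longrightarrow> 0 < pdf f x"
  using Zf_pos[of f] by (simp add: pdf_def)

lemma pdf_nonneg: "continuous_on cube f \<Longrightarrow> 0 \<le> pdf f x"
  using Zf_pos[of f] by (simp add: pdf_def)

lemma integrable_pdf: "continuous_on cube f \<Longrightarrow> integrable lborel (pdf f)"
  using set_integrable_exp[of f] unfolding set_integrable_def pdf_def[abs_def] by simp

lemma borel_measurable_pdf: "continuous_on cube f \<Longrightarrow> pdf f \<in> borel_measurable borel"
  using borel_measurable_integrable[OF integrable_pdf] by simp

lemma integral_pdf: "continuous_on cube f \<Longrightarrow> integral\<^sup>L lborel (pdf f) = 1"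
  using Zf_pos[of f] unfolding pdf_def[abs_def] by (simp add: Zf_def set_lebesgue_integral_def)

lemma Pf_in_Dists: "continuous_on cube f \<Longrightarrow> Pf f \<in> Dists"
  unfolding Pf_eq_density
  by (intro density_in_Dists integrable_pdf integral_pdf pdf_nonneg pdf_outside)

lemma measure_Pf:
  "continuous_on cube f \<Longrightarrow> A \<in> sets borel \<Longrightarrow> measure (Pf f) A = (LINT x|lborel. pdf f x * indicator A x)"
  unfolding Pf_eq_density
  by (intro measure_density_lborel integrable_pdf integral_pdf pdf_nonneg pdf_outside)

lemma integrable_pdf_indicator:
  "continuous_on cube f \<Longrightarrow> A \<in> sets borel \<Longrightarrow> integrable lborel (\<lambda>x. pdf f x * indicator A x)"
  using integrable_mult_indicator[OF _ integrable_pdf[of f], of A] by (simp add: mult.commute)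

lemma prob_space_Pf: "continuous_on cube f \<Longrightarrow> prob_space (Pf f)"
  using Pf_in_Dists[of f] by (simp add: Dists_def)

lemma sets_Pf: "sets (Pf f) = sets borel"
  by (simp add: Pf_def)

context
  fixes f g :: "real^'d \<Rightarrow> real" and \<delta> :: real
  assumes f: "continuous_on cube f" and g: "continuous_on cube g"
    and close: "\<And>x. x \<in> cube \<Longrightarrow> \<bar>f x - g x\<bar> \<le> \<delta>"
begin

text \<open>One \<open>\<delta>\<close> is lost in the exponent and one in the normalising constant.
  The reverse comparison is the same lemma with \<open>f\<close> and \<open>g\<close>
  exchanged.\<close>

lemma pdf_ratio: "exp (- (2 * \<delta>)) * pdf g x \<le> pdf f x"
proof (cases "x \<in> cube")
  case True
  have 1: "g x - \<delta> \<le> f x" using close[OF True] by linarith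
  have 2: "Zf f \<le> exp \<delta> * Zf g" by (rule Zf_le[OF f g]) (use close in \<open>auto simp: abs_le_iff algebra_simps\<close>)
  have "exp (- (2 * \<delta>)) * pdf g x = exp (g x - \<delta>) / (exp \<delta> * Zf g)"
    using True by (simp add: pdf_def exp_diff exp_minus field_simps flip: exp_add)
  also have "\<dots> \<le> exp (f x) / Zf f"
    using 1 2 Zf_pos[OF f] by (intro frac_le) auto
  finally show ?thesis using True by (simp add: pdf_def)
qed (simp add: pdf_def)

lemma close_nonneg: "0 \<le> \<delta>"
  using close[OF cube_zero] by linarith

lemma measure_Pf_ratio: "A \<in> sets borel \<Longrightarrow> exp (- (2 * \<delta>)) * measure (Pf g) A \<le> measure (Pf f) A"
  unfolding measure_Pf[OF f] measure_Pf[OF g] integral_mult_right_zero[symmetric]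
  using pdf_ratio
  by (intro integral_mono integrable_pdf_indicator f Bochner_Integration.integrable_mult_right g)
     (auto simp: indicator_def)

text \<open>The ratio bound leaves at most the fraction \<open>1 - exp (- (2 * \<delta>))\<close> of
  the mass of \<open>A\<close>, and \<open>exp\<close> lies above its tangent at 0.\<close>

lemma measure_Pf_diff:
  assumes "A \<in> sets borel"
  shows "measure (Pf g) A - measure (Pf f) A \<le> 2 * \<delta>"
proof -
  have "1 - exp (- (2 * \<delta>)) \<le> 2 * \<delta>" using exp_ge_add_one_self[of "- (2 * \<delta>)"] by linarith
  moreover have "0 \<le> 1 - exp (- (2 * \<delta>))" using close_nonneg by simp
  moreover have "measure (Pf g) A \<le> 1" "0 \<le> measure (Pf g) A" using prob_space.prob_le_1[OF prob_space_Pf[OF g]] by auto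
  ultimately have "(1 - exp (- (2 * \<delta>))) * measure (Pf g) A \<le> 2 * \<delta>"
    by (meson mult_left_le order_trans)
  then show ?thesis using measure_Pf_ratio[OF assms] by (simp add: algebra_simps)
qed

text \<open>Outside the cube both densities are 0, so the quotient there, division by zero included,
  carries no mass. This exhibits the Radon-Nikodym derivative explicitly.\<close>

lemma Pf_density_ratio: "Pf f = density (Pf g) (\<lambda>x. ennreal (pdf f x / pdf g x))"
proof -
  note [measurable] = borel_measurable_pdf[OF f] borel_measurable_pdf[OF g]
  have "pdf g x * (pdf f x / pdf g x) = pdf f x" for x
    using pdf_pos[OF g, of x] pdf_outside[of x f] by (cases "x \<in> cube") auto
  then have "ennreal (pdf g x) * ennreal (pdf f x / pdf g x) = ennreal (pdf f x)" for x
    using pdf_nonneg[OF f] pdf_nonneg[OF g] by (simp flip: ennreal_mult)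
  then show ?thesis
    unfolding Pf_eq_density by (subst density_density_eq) auto
qed

end

lemma tv_dist_Pf_le:
  assumes "continuous_on cube f" "continuous_on cube g" "\<And>x. x \<in> cube \<Longrightarrow> \<bar>f x - g x\<bar> \<le> \<delta>"
  shows "tv_dist (Pf f) (Pf g) \<le> ereal (min 1 (2 * \<delta>))"
proof -
  have s: "\<And>x. x \<in> cube \<Longrightarrow> \<bar>g x - f x\<bar> \<le> \<delta>" using assms(3) by (simp add: abs_minus_commute)
  have "\<bar>measure (Pf f) A - measure (Pf g) A\<bar> \<le> min 1 (2 * \<delta>)" if "A \<in> sets borel" for A
    using measure_Pf_diff[OF assms that] measure_Pf_diff[OF assms(2,1) s that]
      prob_space.prob_le_1[OF prob_space_Pf[OF assms(1)], of A] prob_space.prob_le_1[OF prob_space_Pf[OF assms(2)], of A]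
      measure_nonneg[of "Pf f" A] measure_nonneg[of "Pf g" A] by linarith
  then show ?thesis unfolding tv_dist_def by (auto intro!: cSUP_least)
qed

text \<open>By uniqueness the Radon-Nikodym derivative is almost everywhere the quotient of the two
  densities, whose logarithm is bounded from both sides by \<open>pdf_ratio\<close>.\<close>

lemma suplog_dist_Pf_le:
  assumes "continuous_on cube f" "continuous_on cube g" "\<And>x. x \<in> cube \<Longrightarrow> \<bar>f x - g x\<bar> \<le> \<delta>"
  shows "suplog_dist (Pf f) (Pf g) \<le> ereal (2 * \<delta>)"
proof -
  have s: "\<And>x. x \<in> cube \<Longrightarrow> \<bar>g x - f x\<bar> \<le> \<delta>" using assms(3) by (simp add: abs_minus_commute)
  note [measurable] = borel_measurable_pdf[OF assms(1)] borel_measurable_pdf[OF assms(2)]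
  have m: "(\<lambda>x. ennreal (pdf f x / pdf g x)) \<in> borel_measurable (Pf g)"
    "(\<lambda>x. ennreal (pdf g x / pdf f x)) \<in> borel_measurable (Pf f)"
    unfolding Pf_def by auto
  interpret Q: prob_space "Pf g" by (rule prob_space_Pf[OF assms(2)])
  have ac: "absolutely_continuous (Pf g) (Pf f)" "absolutely_continuous (Pf f) (Pf g)"
    using absolutely_continuousI_density[OF m(1)] absolutely_continuousI_density[OF m(2)]
    by (simp_all only: Pf_density_ratio[OF assms, symmetric] Pf_density_ratio[OF assms(2,1) s, symmetric])
  have RN: "AE x in Pf g. ennreal (pdf f x / pdf g x) = RN_deriv (Pf g) (Pf f) x"
    by (rule Q.RN_deriv_unique[OF m(1)]) (simp add: Pf_density_ratio[OF assms, symmetric])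
  have "AE x in Pf g. x \<in> cube"
    unfolding Pf_eq_density by (subst AE_density) (auto intro!: AE_I2 intro: ccontr simp: pdf_outside)
  with RN have "AE x in Pf g. ereal \<bar>ln (enn2real (RN_deriv (Pf g) (Pf f) x))\<bar> \<le> ereal (2 * \<delta>)"
  proof eventually_elim
    case (elim x)
    have p: "0 < pdf f x" "0 < pdf g x" using elim pdf_pos assms by auto
    have "exp (- (2 * \<delta>)) * pdf g x \<le> pdf f x" "exp (- (2 * \<delta>)) * pdf f x \<le> pdf g x"
      using pdf_ratio[OF assms] pdf_ratio[OF assms(2,1) s] by auto
    then have "ln (exp (- (2 * \<delta>)) * pdf g x) \<le> ln (pdf f x)" "ln (exp (- (2 * \<delta>)) * pdf f x) \<le> ln (pdf g x)"
      using p by (subst ln_le_cancel_iff; simp)+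
    then have "\<bar>ln (pdf f x / pdf g x)\<bar> \<le> 2 * \<delta>" using p by (simp add: ln_mult ln_div abs_le_iff)
    then show ?case using elim p by (simp flip: elim(1))
  qed
  then show ?thesis
    unfolding suplog_dist_def using ac by (auto intro!: esssup_I)
qed

lemma norm_diff_cube_le:
  fixes x y :: "real^'d"
  assumes "x \<in> cube" "y \<in> cube"
  shows "norm (x - y) \<le> real CARD('d)"
proof -
  have "norm (x - y) \<le> (\<Sum>i\<in>UNIV. \<bar>(x - y) $ i\<bar>)" by (rule norm_le_l1_cart)
  also have "\<dots> \<le> (\<Sum>i\<in>(UNIV::'d set). 1)"
    using assms by (intro sum_mono) (auto simp: cube_def abs_le_iff; smt (verit))
  finally show ?thesis by simp
qed

lemma borel_measurable_fst [measurable]: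
  "fst \<in> borel_measurable (borel :: ('a::topological_space \<times> 'b::topological_space) measure)"
  by (intro borel_measurable_continuous_onI continuous_on_fst continuous_on_id)

lemma borel_measurable_snd [measurable]:
  "snd \<in> borel_measurable (borel :: ('a::topological_space \<times> 'b::topological_space) measure)"
  by (intro borel_measurable_continuous_onI continuous_on_snd continuous_on_id)

text \<open>The coupling keeps both coordinates equal with probability \<open>c\<close> and draws the first one
  independently from \<open>R\<close> otherwise.\<close>

lemma w1_dist_mixture_le:
  fixes P Q R :: "(real^'d) measure"
  assumes PQR: "P \<in> Dists" "Q \<in> Dists" "R \<in> Dists" and c: "0 \<le> c" "c \<le> 1"
    and mix: "\<And>A. A \<in> sets borel \<Longrightarrow> measure P A = c * measure Q A + (1 - c) * measure R A"
  shows "w1_dist P Q \<le> ereal ((1 - c) * real CARD('d))"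
proof -
  interpret P: prob_space P using PQR by (simp add: Dists_def)
  interpret Q: prob_space Q using PQR by (simp add: Dists_def)
  interpret R: prob_space R using PQR by (simp add: Dists_def)
  have sP: "sets P = sets borel" and sQ [measurable_cong]: "sets Q = sets borel" and sR [measurable_cong]: "sets R = sets borel"
    using PQR by (auto simp: Dists_def)
  have sp: "space Q = UNIV" "space R = UNIV" using sets_eq_imp_space_eq[OF sQ] sets_eq_imp_space_eq[OF sR] by simp_all
  interpret QR: pair_prob_space Q R ..
  let ?b = "measure_pmf (bernoulli_pmf c)"
  interpret M: pair_prob_space ?b "Q \<Otimes>\<^sub>M R" ..
  define M where "M = ?b \<Otimes>\<^sub>M (Q \<Otimes>\<^sub>M R)"
  have spM: "space M = UNIV" by (simp add: M_def space_pair_measure sp)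
  have em: "emeasure M (X \<times> (Y \<times> Z)) = emeasure ?b X * (emeasure Q Y * emeasure R Z)"
    if "Y \<in> sets borel" "Z \<in> sets borel" for X Y Z
    unfolding M_def using that
    by (simp add: QR.emeasure_pair_measure_Times R.emeasure_pair_measure_Times sQ sR)
  have sM: "X \<times> (Y \<times> Z) \<in> sets M" if "Y \<in> sets borel" "Z \<in> sets borel" for X Y Z
    unfolding M_def using that by (auto simp: sQ sR)
  define T :: "bool \<times> (real^'d) \<times> (real^'d) \<Rightarrow> (real^'d) \<times> (real^'d)" where
    "T = (\<lambda>z. (if fst z then fst (snd z) else snd (snd z), fst (snd z)))"
  have T1 [measurable]: "(\<lambda>z. if fst z then fst (snd z) else snd (snd z)) \<in> borel_measurable M"
    unfolding M_def by measurable
  have T2 [measurable]: "(\<lambda>z. fst (snd z)) \<in> borel_measurable M"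
    unfolding M_def by measurable
  have T [measurable]: "T \<in> borel_measurable M"
    unfolding T_def by measurable
  let ?\<pi> = "distr M borel T"
  have "?\<pi> \<in> couplings P Q"
    unfolding couplings_def
  proof (intro CollectI conjI)
    show "prob_space ?\<pi>" using M.prob_space_distr T unfolding M_def by blast
    have "distr ?\<pi> borel fst = distr M borel (\<lambda>z. if fst z then fst (snd z) else snd (snd z))"
      by (subst distr_distr) (auto simp: T_def o_def)
    also have "\<dots> = P"
    proof (rule measure_eqI)
      fix A assume "A \<in> sets (distr M borel (\<lambda>z. if fst z then fst (snd z) else snd (snd z)))"
      then have A: "A \<in> sets borel" by simp
      have "emeasure (distr M borel (\<lambda>z. if fst z then fst (snd z) else snd (snd z))) A =
         emeasure M (({True} \<times> (A \<times> UNIV)) \<union> ({False} \<times> (UNIV \<times> A)))"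
        using A by (subst emeasure_distr) (auto simp: spM intro!: arg_cong[where f = "emeasure M"] split: if_splits)
      also have "\<dots> = emeasure M ({True} \<times> (A \<times> UNIV)) + emeasure M ({False} \<times> (UNIV \<times> A))"
        using A by (intro plus_emeasure[symmetric] sM) auto
      also have "\<dots> = ennreal c * emeasure Q A + ennreal (1 - c) * emeasure R A"
        using A c Q.emeasure_space_1 R.emeasure_space_1 by (simp add: em emeasure_pmf_single sp)
      also have "\<dots> = emeasure P A"
        using c mix[OF A]
        by (simp add: P.emeasure_eq_measure Q.emeasure_eq_measure R.emeasure_eq_measure flip: ennreal_mult ennreal_plus)
      finally show "emeasure (distr M borel (\<lambda>z. if fst z then fst (snd z) else snd (snd z))) A = emeasure P A" .
    qed (simp add: sP)
    finally show "distr ?\<pi> borel fst = P" .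
    have "distr ?\<pi> borel snd = distr M borel (\<lambda>z. fst (snd z))"
      by (subst distr_distr) (auto simp: T_def o_def)
    also have "\<dots> = Q"
    proof (rule measure_eqI)
      fix A assume "A \<in> sets (distr M borel (\<lambda>z. fst (snd z)))"
      then have A: "A \<in> sets borel" by simp
      have "emeasure (distr M borel (\<lambda>z. fst (snd z))) A = emeasure M (UNIV \<times> (A \<times> UNIV))"
        using A by (subst emeasure_distr) (auto simp: spM intro!: arg_cong[where f = "emeasure M"])
      also have "\<dots> = emeasure Q A"
        using A measure_pmf.emeasure_space_1[of "bernoulli_pmf c"] R.emeasure_space_1 by (simp add: em sp)
      finally show "emeasure (distr M borel (\<lambda>z. fst (snd z))) A = emeasure Q A" .
    qed (simp add: sQ)
    finally show "distr ?\<pi> borel snd = Q" .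
  qed simp
  then have "(INF \<pi>\<in>couplings P Q. \<integral>\<^sup>+ z. ennreal (norm (fst z - snd z)) \<partial>\<pi>) \<le> (\<integral>\<^sup>+ z. ennreal (norm (fst z - snd z)) \<partial>?\<pi>)"
    by (rule INF_lower)
  also have "\<dots> = (\<integral>\<^sup>+ z. ennreal (norm (fst (T z) - snd (T z))) \<partial>M)"
    by (rule nn_integral_distr) auto
  \<comment> \<open>The coordinates differ only if the coin shows \<open>False\<close>, and then by
    at most the dimension, a crude bound for the diameter of the cube.\<close>
  also have "\<dots> \<le> (\<integral>\<^sup>+ z. ennreal (real CARD('d)) * indicator ({False} \<times> (UNIV \<times> UNIV)) z \<partial>M)"
  proof (rule nn_integral_mono_AE)
    have "emeasure M (UNIV \<times> (cube \<times> cube)) = 1"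
      using PQR measure_pmf.emeasure_space_1[of "bernoulli_pmf c"] by (simp add: em Dists_def)
    then have "AE z in M. z \<in> UNIV \<times> (cube \<times> cube)"
      using M.AE_in_set_eq_1[of "UNIV \<times> (cube \<times> cube)"] sM[of cube cube UNIV] M.emeasure_eq_measure
      unfolding M_def by simp
    then show "AE z in M. ennreal (norm (fst (T z) - snd (T z))) \<le> ennreal (real CARD('d)) * indicator ({False} \<times> (UNIV \<times> UNIV)) z"
    proof eventually_elim
      case (elim z)
      then show ?case
        using norm_diff_cube_le[of "snd (snd z)" "fst (snd z)"]
        by (cases z) (auto simp: T_def indicator_def ennreal_leI simp flip: ennreal_of_nat_eq_real_of_nat)
    qed
  qed
  also have "\<dots> = ennreal (real CARD('d)) * emeasure M ({False} \<times> (UNIV \<times> UNIV))"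
    by (intro nn_integral_cmult_indicator sM) auto
  also have "emeasure M ({False} \<times> (UNIV \<times> UNIV)) = ennreal (1 - c)"
    using c Q.emeasure_space_1 R.emeasure_space_1 by (subst em) (simp_all add: emeasure_pmf_single sp)
  also have "ennreal (real CARD('d)) * ennreal (1 - c) = ennreal ((1 - c) * real CARD('d))"
    using c by (simp add: mult.commute del: ennreal_of_nat_eq_real_of_nat flip: ennreal_mult)
  finally have "(INF \<pi>\<in>couplings P Q. \<integral>\<^sup>+ z. ennreal (norm (fst z - snd z)) \<partial>\<pi>) \<le> ennreal ((1 - c) * real CARD('d))" .
  then have "w1_dist P Q \<le> enn2ereal (ennreal ((1 - c) * real CARD('d)))"
    unfolding w1_dist_def by (simp add: less_eq_ennreal.rep_eq)
  then show ?thesis using c by (simp add: enn2ereal_ennreal)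
qed

text \<open>By \<open>pdf_ratio\<close>, the measure \<open>Pf g\<close> scaled by
  \<open>c = exp (- (2 * \<delta>))\<close> fits below \<open>Pf f\<close>; \<open>\<rho>\<close> is
  what remains, normalised. Positivity of \<open>\<delta>\<close> gives \<open>c < 1\<close>, so
  this division is legitimate.\<close>

lemma w1_dist_Pf_le:
  fixes f g :: "real^'d \<Rightarrow> real"
  assumes "continuous_on cube f" "continuous_on cube g" "\<And>x. x \<in> cube \<Longrightarrow> \<bar>f x - g x\<bar> \<le> \<delta>" and \<delta>: "\<delta> > 0"
  shows "w1_dist (Pf f) (Pf g) \<le> ereal (real CARD('d) * min 1 (2 * \<delta>))"
proof -
  define c where "c = exp (- (2 * \<delta>))"
  have c: "0 < c" "c < 1" using \<delta> by (auto simp: c_def)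
  have c2: "1 - c \<le> 2 * \<delta>" unfolding c_def using exp_ge_add_one_self[of "- (2 * \<delta>)"] by linarith
  define \<rho> where "\<rho> = (\<lambda>x. (pdf f x - c * pdf g x) / (1 - c))"
  have \<rho>: "integrable lborel \<rho>" "\<And>x. 0 \<le> \<rho> x" "integral\<^sup>L lborel \<rho> = 1" "\<And>x. x \<notin> cube \<Longrightarrow> \<rho> x = 0"
  proof -
    show "integrable lborel \<rho>" unfolding \<rho>_def using integrable_pdf assms(1,2)
      by (intro integrable_divide Bochner_Integration.integrable_diff integrable_mult_right)
    show "0 \<le> \<rho> x" for x unfolding \<rho>_def c_def using c pdf_ratio[OF assms(1-3)] by (auto simp: c_def)
    have "integral\<^sup>L lborel \<rho> = (integral\<^sup>L lborel (pdf f) - c * integral\<^sup>L lborel (pdf g)) / (1 - c)"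
      unfolding \<rho>_def using assms integrable_pdf by (subst integral_divide_zero, subst Bochner_Integration.integral_diff) auto
    then show "integral\<^sup>L lborel \<rho> = 1" using assms c by (simp add: integral_pdf)
    show "\<rho> x = 0" if "x \<notin> cube" for x using that by (simp add: \<rho>_def pdf_outside)
  qed
  have "w1_dist (Pf f) (Pf g) \<le> ereal ((1 - c) * real CARD('d))"
  proof (rule w1_dist_mixture_le[OF Pf_in_Dists Pf_in_Dists density_in_Dists[OF \<rho>]])
    fix A :: "(real^'d) set" assume A: "A \<in> sets borel"
    have "(1 - c) * (LINT x|lborel. \<rho> x * indicator A x) = (LINT x|lborel. pdf f x * indicator A x - c * (pdf g x * indicator A x))"
      using c unfolding integral_mult_right_zero[symmetric]
      by (intro Bochner_Integration.integral_cong) (auto simp: \<rho>_def indicator_def)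
    also have "\<dots> = measure (Pf f) A - c * measure (Pf g) A"
      using assms A integrable_pdf_indicator by (subst Bochner_Integration.integral_diff) (auto simp: measure_Pf)
    finally show "measure (Pf f) A = c * measure (Pf g) A + (1 - c) * measure (density lborel (\<lambda>x. ennreal (\<rho> x))) A"
      by (simp add: measure_density_lborel[OF \<rho> A])
  qed (use assms c in auto)
  also have "(1 - c) * real CARD('d) \<le> real CARD('d) * min 1 (2 * \<delta>)"
    using c c2 by (subst mult.commute, intro mult_left_mono) auto
  finally show ?thesis by simp
qed

subsection \<open>Reductions for the minimal errors\<close>

text \<open>The length of the list of answers tells how many queries were made, so an adaptive
  strategy can replay a fixed list of points.\<close>

lemma err_ad_le_err_na:
  fixes Out :: "'o set"
  assumes "X \<noteq> {}"
  shows "err_ad n X F S Out D \<le> err_na n X F S Out D"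
  unfolding err_na_def
proof (intro INF_greatest)
  fix xs and \<phi> :: "real list \<Rightarrow> 'o" assume xs: "xs \<in> {xs. length xs = n \<and> set xs \<subseteq> X}" and \<phi>: "\<phi> \<in> {\<phi>. \<forall>v. \<phi> v \<in> Out}"
  obtain x0 where x0: "x0 \<in> X" using assms by blast
  define pt where "pt v = (if length v < n then xs ! length v else x0)" for v :: "real list"
  have "ad_info pt f k = map f (take k xs)" if "k \<le> n" for f k
    using that xs by (induction k) (auto simp: pt_def take_Suc_conv_app_nth)
  from this[of n] have info: "ad_info pt f n = map f xs" for f using xs by simp
  have pt: "pt \<in> {pt. \<forall>v. pt v \<in> X}" using xs x0 by (auto simp: pt_def)
  have "err_ad n X F S Out D \<le> (SUP f\<in>F. D (S f) (\<phi> (ad_info pt f n)))"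
    unfolding err_ad_def by (rule INF_lower2[OF pt], rule INF_lower2[OF \<phi>]) simp
  then show "err_ad n X F S Out D \<le> (SUP f\<in>F. D (S f) (\<phi> (map f xs)))" by (simp add: info)
qed

lemma err_na_le:
  assumes xs: "length xs = n" "set xs \<subseteq> X" and F: "f0 \<in> F" "\<And>f. f \<in> F \<Longrightarrow> S f \<in> Out"
    and D: "\<And>f g. f \<in> F \<Longrightarrow> g \<in> F \<Longrightarrow> (\<And>x. x \<in> set xs \<Longrightarrow> f x = g x) \<Longrightarrow> D (S f) (S g) \<le> c"
  shows "err_na n X F S Out D \<le> c"
proof -
  \<comment> \<open>Data that no member of the class produces are sent to \<open>f0\<close>, since
    the answer map must be total with values in \<open>Out\<close>.\<close>
  define sel where "sel v = (if \<exists>f\<in>F. map f xs = v then SOME f. f \<in> F \<and> map f xs = v else f0)" for v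
  have *: "sel v \<in> F \<and> map (sel v) xs = v" if "\<exists>f\<in>F. map f xs = v" for v
    unfolding sel_def using that someI_ex[of "\<lambda>f. f \<in> F \<and> map f xs = v"] by auto
  have sel: "sel v \<in> F" for v
    using * F(1) by (cases "\<exists>f\<in>F. map f xs = v") (auto simp: sel_def)
  have sel_map: "map (sel (map f xs)) xs = map f xs" if "f \<in> F" for f
    using * that by blast
  have xs': "xs \<in> {xs. length xs = n \<and> set xs \<subseteq> X}" using xs by auto
  have "(\<lambda>v. S (sel v)) \<in> {\<phi>. \<forall>v. \<phi> v \<in> Out}" using sel F(2) by auto
  from INF_lower[OF this] have "err_na n X F S Out D \<le> (SUP f\<in>F. D (S f) (S (sel (map f xs))))"
    unfolding err_na_def by (intro INF_lower2[OF xs'])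
  also have "\<dots> \<le> c"
  proof (rule SUP_least)
    fix f assume f: "f \<in> F"
    show "D (S f) (S (sel (map f xs))) \<le> c"
      by (rule D[OF f sel]) (use sel_map[OF f] in \<open>auto simp: map_eq_conv\<close>)
  qed
  finally show ?thesis .
qed

text \<open>The points to be fooled are those queried when the input is \<open>f0\<close>. Agreement
  there makes the answers, hence the next queries, coincide by induction, so \<open>f\<close> and
  \<open>f0\<close> receive the same output \<open>Q\<close>. Queries may repeat, which is why only
  \<open>card pts \<le> n\<close> is asked.\<close>

lemma err_ad_ge:
  fixes Out :: "'o set"
  assumes f0: "f0 \<in> F"
    and fool: "\<And>pts. finite pts \<Longrightarrow> card pts \<le> n \<Longrightarrow>
      \<exists>f\<in>F. (\<forall>x\<in>pts. f x = f0 x) \<and> (\<forall>Q\<in>Out. c \<le> max (D (S f) Q) (D (S f0) Q))"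
  shows "c \<le> err_ad n X F S Out D"
  unfolding err_ad_def
proof (intro INF_greatest)
  fix pt and \<phi> :: "real list \<Rightarrow> 'o" assume "\<phi> \<in> {\<phi>. \<forall>v. \<phi> v \<in> Out}"
  then have \<phi>: "\<phi> v \<in> Out" for v by blast
  let ?pts = "(\<lambda>k. pt (ad_info pt f0 k)) ` {..<n}"
  have "card ?pts \<le> n" using card_image_le[of "{..<n}"] by (metis card_lessThan finite_lessThan)
  with fool[of ?pts] obtain f where f: "f \<in> F" "\<And>x. x \<in> ?pts \<Longrightarrow> f x = f0 x"
    and c: "\<And>Q. Q \<in> Out \<Longrightarrow> c \<le> max (D (S f) Q) (D (S f0) Q)" by auto
  have "ad_info pt f k = ad_info pt f0 k" if "k \<le> n" for k
    using that by (induction k) (use f(2) in auto)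
  then have info: "ad_info pt f n = ad_info pt f0 n" by simp
  have "c \<le> max (D (S f) (\<phi> (ad_info pt f n))) (D (S f0) (\<phi> (ad_info pt f0 n)))"
    using c[OF \<phi>] by (simp add: info)
  also have "\<dots> \<le> (SUP f\<in>F. D (S f) (\<phi> (ad_info pt f n)))"
    using f(1) f0 by (intro max.boundedI SUP_upper)
  finally show "c \<le> (SUP f\<in>F. D (S f) (\<phi> (ad_info pt f n)))" .
qed

text \<open>A functional that is 1-Lipschitz with respect to the distance replaces the triangle inequality.\<close>

lemma err_ad_ge_functional:
  fixes \<Phi> :: "'o \<Rightarrow> real"
  assumes f0: "f0 \<in> F"
    and fool: "\<And>pts. finite pts \<Longrightarrow> card pts \<le> n \<Longrightarrow>
      \<exists>f\<in>F. (\<forall>x\<in>pts. f x = f0 x) \<and> 2 * c \<le> \<bar>\<Phi> (S f) - \<Phi> (S f0)\<bar>"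
    and lip: "\<And>f Q. f \<in> F \<Longrightarrow> Q \<in> Out \<Longrightarrow> ereal \<bar>\<Phi> (S f) - \<Phi> Q\<bar> \<le> D (S f) Q"
  shows "ereal c \<le> err_ad n X F S Out D"
proof (rule err_ad_ge[of f0], rule f0)
  fix pts :: "'a set" assume pts: "finite pts" "card pts \<le> n"
  then obtain f where f: "f \<in> F" "\<forall>x\<in>pts. f x = f0 x" "2 * c \<le> \<bar>\<Phi> (S f) - \<Phi> (S f0)\<bar>" using fool by blast
  have "ereal c \<le> max (D (S f) Q) (D (S f0) Q)" if Q: "Q \<in> Out" for Q
  proof -
    have "c \<le> max \<bar>\<Phi> (S f) - \<Phi> Q\<bar> \<bar>\<Phi> (S f0) - \<Phi> Q\<bar>" using f(3) by linarith
    then have "ereal c \<le> max (ereal \<bar>\<Phi> (S f) - \<Phi> Q\<bar>) (ereal \<bar>\<Phi> (S f0) - \<Phi> Q\<bar>)"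
      by (simp add: max_def split: if_splits)
    also have "\<dots> \<le> max (D (S f) Q) (D (S f0) Q)" using lip[OF f(1) Q] lip[OF f0 Q] by (rule max.mono)
    finally show ?thesis .
  qed
  with f show "\<exists>f\<in>F. (\<forall>x\<in>pts. f x = f0 x) \<and> (\<forall>Q\<in>Out. ereal c \<le> max (D (S f) Q) (D (S f0) Q))" by blast
qed

text \<open>An upper bound for the larger error \<open>e1\<close> and a lower bound for the smaller
  \<open>e2\<close> give all four estimates; later \<open>e1\<close> is nonadaptive and
  \<open>e2\<close> adaptive.\<close>

lemma Theta_pairI:
  assumes up: "\<exists>C>0. \<forall>B>0. \<forall>n\<ge>1. e1 B n \<le> ereal (C * h B n)"
    and low: "\<exists>c>0. \<forall>B>0. \<forall>n\<ge>1. ereal (c * h B n) \<le> e2 B n"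
    and le: "\<And>B n. e2 B n \<le> e1 B n"
  shows "Theta e1 h \<and> Theta e2 h"
proof -
  obtain c where c: "c > 0" "\<And>B n. B > 0 \<Longrightarrow> n \<ge> 1 \<Longrightarrow> ereal (c * h B n) \<le> e2 B n" using low by blast
  have L: "ereal (h B n) \<le> ereal (1 / c) * e" if "B > 0" "n \<ge> 1" "e2 B n \<le> e" for B n e
  proof -
    have "ereal (h B n) = ereal (1 / c) * ereal (c * h B n)" using c(1) by simp
    also have "\<dots> \<le> ereal (1 / c) * e" using c that by (intro ereal_mult_left_mono) (auto intro: order_trans)
    finally show ?thesis .
  qed
  have "\<exists>C>0. \<forall>B>0. \<forall>n\<ge>1. ereal (h B n) \<le> ereal C * e1 B n" "\<exists>C>0. \<forall>B>0. \<forall>n\<ge>1. ereal (h B n) \<le> ereal C * e2 B n"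
    using L le c(1) by (auto intro!: exI[of _ "1 / c"])
  moreover have "\<exists>C>0. \<forall>B>0. \<forall>n\<ge>1. e2 B n \<le> ereal (C * h B n)" using up le by (meson order_trans)
  ultimately show ?thesis using up unfolding Theta_def by blast
qed

subsection \<open>Lower bounds through functionals\<close>

text \<open>Jensen's inequality by hand: \<open>exp\<close> lies above its tangent at the mean value
  \<open>?a\<close>, and integrating the tangent over the cube of volume 1 leaves
  \<open>exp ?a\<close>.\<close>

lemma exp_integral_le_Zf:
  fixes f :: "real^'d \<Rightarrow> real"
  assumes "continuous_on cube f"
  shows "exp (LINT x:cube|lborel. f x) \<le> Zf f"
proof -
  let ?a = "LINT x:cube|lborel. f x"
  have i: "set_integrable lborel cube f" by (rule set_integrable_cube[OF assms])
  have c: "set_integrable lborel (cube :: (real^'d) set) (\<lambda>_. c :: real)" for c by (rule set_integrable_cube) simp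
  have cube: "(LINT x:(cube :: (real^'d) set)|lborel. c :: real) = c" for c
    by (simp add: set_lebesgue_integral_def measure_lborel_cube)
  have "exp ?a = exp ?a * (?a + (1 - ?a))" by simp
  also have "\<dots> = (LINT x:cube|lborel. exp ?a * (f x + (1 - ?a)))"
    by (simp only: set_integral_mult_right set_integral_add(2)[OF i c] cube)
  also have "\<dots> \<le> (LINT x:cube|lborel. exp (f x))"
  proof (rule set_integral_mono)
    fix x :: "real^'d" assume "x \<in> cube"
    have "f x + (1 - ?a) \<le> exp (f x - ?a)"
      using exp_ge_add_one_self[of "f x - ?a"] by linarith
    then have "exp ?a * (f x + (1 - ?a)) \<le> exp ?a * exp (f x - ?a)"
      by (intro mult_left_mono) auto
    then show "exp ?a * (f x + (1 - ?a)) \<le> exp (f x)" by (simp flip: exp_add)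
  qed (use i c set_integrable_exp[OF assms] in auto)
  finally show ?thesis by (simp add: Zf_def)
qed

lemma integral_Pf:
  fixes u :: "real^'d \<Rightarrow> real"
  assumes "continuous_on cube f" "u \<in> borel_measurable borel"
  shows "(LINT x|Pf f. u x) = (LINT x|lborel. pdf f x * u x)"
  unfolding Pf_eq_density using assms borel_measurable_pdf[OF assms(1)] pdf_nonneg[OF assms(1)]
  by (subst integral_density) auto

text \<open>Where \<open>f\<close> vanishes, its density on the cube is \<open>1 / Zf f\<close>,
  against 1 for the uniform distribution.\<close>

lemma integral_Pf_eq_divide_Zf:
  fixes u :: "real^'d \<Rightarrow> real"
  assumes "continuous_on cube f" "u \<in> borel_measurable borel" "\<And>x. f x = 0 \<or> u x = 0"
  shows "(LINT x|Pf f. u x) = (LINT x|Pf (\<lambda>_. 0). u x) / Zf f"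
proof -
  have "pdf f x * u x = pdf (\<lambda>_. 0) x * u x / Zf f" for x
    using assms(3)[of x] by (auto simp: pdf_def Zf_const)
  then show ?thesis
    by (simp add: integral_Pf[OF assms(1,2)] integral_Pf[OF continuous_on_const assms(2)])
qed

lemma integral_indicator_Pf: "A \<in> sets borel \<Longrightarrow> (LINT x|Pf f. indicator A x) = measure (Pf f) A"
  by (simp add: sets_Pf sets_eq_imp_space_eq[OF sets_Pf])

section \<open>Test functionals on the untouched half\<close>

definition right_half :: "'d \<Rightarrow> (real^'d) set" where
  "right_half i = {x. x $ i > 1/2}"

lemma right_half_borel [measurable]: "right_half i \<in> sets borel"
  unfolding right_half_def by measurable

text \<open>A Lipschitz substitute for the indicator of \<open>right_half\<close>, as the
  Wasserstein distance requires. On the cube the cap at 1 is inactive; it makes the function bounded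
  on the whole space and so integrable against every probability measure.\<close>

definition ramp :: "'d \<Rightarrow> real^'d \<Rightarrow> real" where
  "ramp i x = min 1 (max 0 (x $ i - 1/2))"

lemma ramp_borel [measurable]: "ramp i \<in> borel_measurable borel"
  unfolding ramp_def by measurable

lemma ramp_bounds: "0 \<le> ramp i x" "ramp i x \<le> 1"
  by (auto simp: ramp_def)

lemma ramp_lipschitz: "\<bar>ramp i x - ramp i y\<bar> \<le> norm (x - y)"
proof -
  have "\<bar>ramp i x - ramp i y\<bar> \<le> \<bar>(x - y) $ i\<bar>" by (auto simp: ramp_def)
  then show ?thesis using component_le_norm_cart[of "x - y" i] by linarith
qed

lemma integrable_ramp:
  assumes "finite_measure M" "sets M = sets borel"
  shows "integrable M (ramp i)"
proof -
  have "ramp i \<in> borel_measurable M" using ramp_borel measurable_cong_sets[OF assms(2) refl] by blast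
  then show ?thesis
    by (intro finite_measure.integrable_const_bound[OF assms(1), of _ 1] AE_I2) (simp_all add: ramp_bounds)
qed

text \<open>On the box where all coordinates lie between \<open>3/4\<close> and 1 the ramp is at
  least \<open>1/4\<close>.\<close>

lemma ramp_integral_pos:
  fixes i :: "'d::finite"
  shows "0 < (LINT x|Pf (\<lambda>_. 0). ramp i x)"
proof -
  let ?E = "cbox (\<chi> j. 3/4) 1 :: (real^'d) set"
  have "measure lborel ?E = (\<Prod>j\<in>UNIV. (1 :: real^'d) $ j - (\<chi> j. 3/4) $ j)"
    by (rule content_cbox_cart) (simp add: interval_ne_empty_cart)
  then have "0 < measure lborel ?E" by (simp add: prod_pos)
  then have "0 < (LINT x|lborel. 1/4 * indicator ?E x :: real)" by simp
  also have "\<dots> \<le> (LINT x|lborel. pdf (\<lambda>_. 0) x * ramp i x)"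
  proof (rule integral_mono)
    show "integrable lborel (\<lambda>x. 1/4 * indicator ?E x :: real)"
      by (intro integrable_mult_right) (auto simp: integrable_indicator_iff emeasure_lborel_cbox_eq)
    show "integrable lborel (\<lambda>x. pdf (\<lambda>_. 0) x * ramp i x)"
    proof (rule Bochner_Integration.integrable_bound)
      show "integrable lborel (pdf (\<lambda>_::real^'d. 0))" by (rule integrable_pdf) simp
      have [measurable]: "pdf (\<lambda>_::real^'d. 0) \<in> borel_measurable borel" by (rule borel_measurable_pdf) simp
      show "(\<lambda>x. pdf (\<lambda>_. 0) x * ramp i x) \<in> borel_measurable lborel" by measurable
      show "AE x in lborel. norm (pdf (\<lambda>_. 0) x * ramp i x) \<le> norm (pdf (\<lambda>_. 0) x)"
        using ramp_bounds[of i] by (intro AE_I2) (simp add: abs_mult mult_left_le)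
    qed
    fix x :: "real^'d"
    show "1/4 * indicator ?E x \<le> pdf (\<lambda>_. 0) x * ramp i x"
    proof (cases "x \<in> ?E")
      case True
      then have x: "3/4 \<le> x $ j" "x $ j \<le> 1" for j by (auto simp: mem_box_cart)
      have "0 \<le> x $ j" for j using x(1)[of j] by linarith
      then have "x \<in> cube" using x(2) by (simp add: cube_def)
      moreover have "1/4 \<le> ramp i x" using x[of i] by (simp add: ramp_def)
      ultimately show ?thesis using True by (simp add: pdf_def Zf_const)
    qed (auto intro!: mult_nonneg_nonneg pdf_nonneg ramp_bounds)
  qed
  finally show ?thesis by (simp add: integral_Pf)
qed

lemma right_half_pos:
  fixes i :: "'d::finite"
  shows "0 < measure (Pf (\<lambda>_. 0)) (right_half i)"
proof -
  interpret prob_space "Pf (\<lambda>_. 0) :: (real^'d) measure" by (rule prob_space_Pf) simp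
  have "(LINT x|Pf (\<lambda>_. 0). ramp i x) \<le> (LINT x|Pf (\<lambda>_. 0). indicator (right_half i) x)"
  proof (rule integral_mono)
    show "integrable (Pf (\<lambda>_. 0)) (ramp i)"
      by (rule integrable_ramp) (auto simp: sets_Pf intro: finite_measure_axioms)
    show "integrable (Pf (\<lambda>_. 0)) (indicator (right_half i) :: _ \<Rightarrow> real)"
      by (simp add: sets_Pf integrable_indicator_iff emeasure_eq_measure)
  qed (auto simp: ramp_def right_half_def indicator_def)
  then show ?thesis using ramp_integral_pos[of i] by (simp add: integral_indicator_Pf del: Bochner_Integration.integral_indicator)
qed

lemma tv_dist_ge:
  fixes P Q :: "(real^'d) measure"
  assumes "P \<in> Dists" "Q \<in> Dists" "A \<in> sets borel"
  shows "ereal \<bar>measure P A - measure Q A\<bar> \<le> tv_dist P Q"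
proof -
  have pq: "prob_space P" "prob_space Q" using assms by (auto simp: Dists_def)
  have "\<bar>measure P A - measure Q A\<bar> \<le> 1" for A
    using prob_space.prob_le_1[OF pq(1), of A] prob_space.prob_le_1[OF pq(2), of A]
      measure_nonneg[of P A] measure_nonneg[of Q A] by linarith
  then show ?thesis unfolding tv_dist_def using assms(3)
    by (auto intro!: cSUP_upper bdd_aboveI2)
qed

text \<open>The easy half of Kantorovich-Rubinstein duality: under any coupling the difference of
  the two integrals is the integral of \<open>u (fst z) - u (snd z)\<close>.\<close>

lemma w1_dist_ge:
  fixes P Q :: "(real^'d) measure"
  assumes u [measurable]: "u \<in> borel_measurable borel"
    and bdd: "\<And>x. \<bar>u x\<bar> \<le> (1::real)" and lip: "\<And>x y. \<bar>u x - u y\<bar> \<le> norm (x - y)"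
  shows "ereal \<bar>(LINT x|P. u x) - (LINT x|Q. u x)\<bar> \<le> w1_dist P Q"
proof -
  have "ennreal \<bar>(LINT x|P. u x) - (LINT x|Q. u x)\<bar> \<le> (\<integral>\<^sup>+ z. ennreal (norm (fst z - snd z)) \<partial>\<pi>)"
    if \<pi>: "\<pi> \<in> couplings P Q" for \<pi>
  proof -
    have s [measurable_cong]: "sets \<pi> = sets borel" and PQ: "P = distr \<pi> borel fst" "Q = distr \<pi> borel snd"
      using \<pi> by (auto simp: couplings_def)
    interpret prob_space \<pi> using \<pi> by (simp add: couplings_def)
    have i: "integrable \<pi> (\<lambda>z. u (fst z))" "integrable \<pi> (\<lambda>z. u (snd z))"
      using bdd by (auto intro!: integrable_const_bound[of _ 1])
    have "(LINT x|P. u x) - (LINT x|Q. u x) = (LINT z|\<pi>. u (fst z) - u (snd z))"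
      unfolding PQ using i by (simp add: integral_distr)
    then have "\<bar>(LINT x|P. u x) - (LINT x|Q. u x)\<bar> \<le> (LINT z|\<pi>. \<bar>u (fst z) - u (snd z)\<bar>)"
      using integral_abs_bound[of \<pi> "\<lambda>z. u (fst z) - u (snd z)"] by simp
    then have "ennreal \<bar>(LINT x|P. u x) - (LINT x|Q. u x)\<bar> \<le> ennreal (LINT z|\<pi>. \<bar>u (fst z) - u (snd z)\<bar>)"
      by (rule ennreal_leI)
    also have "\<dots> = (\<integral>\<^sup>+ z. ennreal \<bar>u (fst z) - u (snd z)\<bar> \<partial>\<pi>)"
      using i by (intro nn_integral_eq_integral[symmetric] integrable_abs Bochner_Integration.integrable_diff) auto
    also have "\<dots> \<le> (\<integral>\<^sup>+ z. ennreal (norm (fst z - snd z)) \<partial>\<pi>)"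
      using lip by (intro nn_integral_mono ennreal_leI) auto
    finally show ?thesis .
  qed
  then have "ennreal \<bar>(LINT x|P. u x) - (LINT x|Q. u x)\<bar> \<le> (INF \<pi>\<in>couplings P Q. \<integral>\<^sup>+ z. ennreal (norm (fst z - snd z)) \<partial>\<pi>)"
    by (rule INF_greatest)
  then have "enn2ereal (ennreal \<bar>(LINT x|P. u x) - (LINT x|Q. u x)\<bar>) \<le> w1_dist P Q"
    unfolding w1_dist_def by (simp add: less_eq_ennreal.rep_eq)
  then show ?thesis by (simp add: enn2ereal_ennreal)
qed

text \<open>If the distance is a finite \<open>\<epsilon>\<close>, the density of \<open>P\<close>
  with respect to \<open>Q\<close> lies between \<open>exp (- \<epsilon>)\<close> and
  \<open>exp \<epsilon>\<close> almost everywhere, and integrating over \<open>A\<close> preserves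
  this.\<close>

lemma suplog_dist_ge:
  fixes P Q :: "(real^'d) measure"
  assumes PQ: "P \<in> Dists" "Q \<in> Dists" and A: "A \<in> sets borel" "0 < measure P A"
  shows "ereal \<bar>ln (measure P A) - ln (measure Q A)\<bar> \<le> suplog_dist P Q"
proof (cases "absolutely_continuous P Q \<and> absolutely_continuous Q P")
  case False
  then show ?thesis by (auto simp: suplog_dist_def)
next
  case True
  interpret P: prob_space P using PQ by (simp add: Dists_def)
  interpret Q: prob_space Q using PQ by (simp add: Dists_def)
  have s: "sets P = sets borel" "sets Q = sets borel" using PQ by (auto simp: Dists_def)
  let ?r = "RN_deriv Q P"
  let ?e = "esssup Q (\<lambda>x. ereal \<bar>ln (enn2real (?r x))\<bar>)"
  have D: "suplog_dist P Q = ?e" using True by (simp add: suplog_dist_def)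
  show ?thesis
  proof (cases ?e)
    case PInf
    then show ?thesis by (simp add: D)
  next
    case MInf
    have "esssup Q (\<lambda>x. 0 :: ereal) \<le> ?e" by (rule esssup_mono) auto
    moreover have "esssup Q (\<lambda>x. 0 :: ereal) = 0" using Q.emeasure_space_1 by (intro esssup_const) auto
    ultimately show ?thesis using MInf by simp
  next
    case (real \<epsilon>)
    have dens: "density Q ?r = P" using True s by (intro Q.density_RN_deriv) auto
    have "AE x in Q. ereal \<bar>ln (enn2real (?r x))\<bar> \<le> ereal \<epsilon>"
      using esssup_AE[of "\<lambda>x. ereal \<bar>ln (enn2real (?r x))\<bar>" Q] real by simp
    moreover have "AE x in Q. ?r x \<noteq> \<infinity>"
      using True s by (intro Q.RN_deriv_finite P.sigma_finite_measure_axioms) auto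
    moreover have "AE x in Q. ?r x \<noteq> 0"
    proof -
      have "AE x in density Q ?r. 0 < ?r x" by (subst AE_density) auto
      then have "AE x in P. 0 < ?r x" by (simp only: dens)
      then have "AE x in Q. 0 < ?r x"
        by (rule absolutely_continuous_AE[rotated 2]) (use True s in auto)
      then show ?thesis by (rule eventually_mono) auto
    qed
    ultimately have r: "AE x in Q. ennreal (exp (- \<epsilon>)) \<le> ?r x \<and> ?r x \<le> ennreal (exp \<epsilon>)"
    proof eventually_elim
      case (elim x)
      then obtain t where t: "?r x = ennreal t" "0 < t" by (cases "?r x") (auto simp: less_le)
      then have "\<bar>ln t\<bar> \<le> \<epsilon>" using elim by simp
      then have "exp (- \<epsilon>) \<le> exp (ln t)" "exp (ln t) \<le> exp \<epsilon>" by auto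
      then show ?case using t by (simp add: ennreal_leI)
    qed
    have em: "emeasure P A = (\<integral>\<^sup>+x. ?r x * indicator A x \<partial>Q)"
      using A s by (subst dens[symmetric], subst emeasure_density) auto
    have "emeasure P A \<le> (\<integral>\<^sup>+x. ennreal (exp \<epsilon>) * indicator A x \<partial>Q)"
      unfolding em by (rule nn_integral_mono_AE, use r in eventually_elim) (auto simp: indicator_def)
    also have "\<dots> = ennreal (exp \<epsilon>) * emeasure Q A" using A s by (simp add: nn_integral_cmult_indicator)
    finally have 1: "measure P A \<le> exp \<epsilon> * measure Q A"
      by (simp add: P.emeasure_eq_measure Q.emeasure_eq_measure flip: ennreal_mult)
    have "ennreal (exp (- \<epsilon>)) * emeasure Q A = (\<integral>\<^sup>+x. ennreal (exp (- \<epsilon>)) * indicator A x \<partial>Q)"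
      using A s by (simp add: nn_integral_cmult_indicator)
    also have "\<dots> \<le> emeasure P A"
      unfolding em by (rule nn_integral_mono_AE, use r in eventually_elim) (auto simp: indicator_def)
    finally have 2: "exp (- \<epsilon>) * measure Q A \<le> measure P A"
      by (simp add: P.emeasure_eq_measure Q.emeasure_eq_measure flip: ennreal_mult)
    have Q0: "0 < measure Q A"
    proof (rule ccontr)
      assume "\<not> 0 < measure Q A"
      then have "measure Q A = 0" using measure_nonneg[of Q A] by linarith
      then show False using 1 A(2) by simp
    qed
    have "ln (measure P A) \<le> ln (exp \<epsilon> * measure Q A)" "ln (exp (- \<epsilon>) * measure Q A) \<le> ln (measure P A)"
      using 1 2 A(2) Q0 by (subst ln_le_cancel_iff; simp)+
    then have "\<bar>ln (measure P A) - ln (measure Q A)\<bar> \<le> \<epsilon>" using Q0 by (simp add: ln_mult)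
    then show ?thesis by (simp add: D real)
  qed
qed

subsection \<open>Rates\<close>

lemma Cm_bdd_zero: "B > 0 \<Longrightarrow> Cm_bdd m B X (\<lambda>_. 0)"
proof (induction m)
  case (Suc m)
  then show ?case by (auto simp: has_partial_within_def intro!: exI[of _ "\<lambda>_. 0"])
qed simp

lemma zero_in_Fcls: "B > 0 \<Longrightarrow> (\<lambda>_. 0) \<in> Fcls m B"
  by (simp add: Fcls_def Cm_bdd_zero)

lemma Fcls_continuous_on: "f \<in> Fcls m B \<Longrightarrow> continuous_on cube f"
  by (auto simp: Fcls_def dest: Cm_bdd_continuous_on)

lemma err_na_upper:
  fixes S :: "(real^'d \<Rightarrow> real) \<Rightarrow> 'o"
  assumes D: "\<And>f g \<delta>. continuous_on cube f \<Longrightarrow> continuous_on cube g \<Longrightarrow>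
      (\<And>x. x \<in> cube \<Longrightarrow> \<bar>f x - g x\<bar> \<le> \<delta>) \<Longrightarrow> 0 < \<delta> \<Longrightarrow> D (S f) (S g) \<le> ereal (\<psi> \<delta>)"
    and Out: "\<And>f. continuous_on cube f \<Longrightarrow> S f \<in> Out"
  shows "\<exists>C>0. \<forall>B>0. \<forall>n\<ge>1. err_na n cube (Fcls m B) S Out D
      \<le> ereal (\<psi> (C * (B * real n powr (- (real m / real CARD('d))))))"
proof -
  obtain C where C0: "C > 0" and C: "\<And>n. n \<ge> 1 \<Longrightarrow> \<exists>xs. length xs = n \<and> set xs \<subseteq> (cube :: (real^'d) set) \<and>
     (\<forall>B h. Cm_bdd m B cube h \<longrightarrow> (\<forall>x\<in>set xs. h x = 0) \<longrightarrow>
        (\<forall>x\<in>cube. \<bar>h x\<bar> \<le> C * (B * real n powr (- (real m / real CARD('d))))))"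
    using sampling_inequality[of m, where 'd='d] by auto
  show ?thesis
  proof (intro exI[of _ "2 * C"] conjI allI impI)
    fix B :: real and n :: nat assume B: "B > 0" and n: "n \<ge> 1"
    let ?h = "B * real n powr (- (real m / real CARD('d)))"
    obtain xs where xs: "length xs = n" "set xs \<subseteq> (cube :: (real^'d) set)"
      and X: "\<And>B h x. Cm_bdd m B cube h \<Longrightarrow> (\<forall>x\<in>set xs. h x = 0) \<Longrightarrow> x \<in> cube \<Longrightarrow>
         \<bar>h x\<bar> \<le> C * (B * real n powr (- (real m / real CARD('d))))"
      using C[OF n] by blast
    show "err_na n cube (Fcls m B) S Out D \<le> ereal (\<psi> (2 * C * ?h))"
    proof (rule err_na_le[OF xs zero_in_Fcls[OF B]])
      show "S f \<in> Out" if "f \<in> Fcls m B" for f using that Out Fcls_continuous_on by blast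
      fix f g assume f: "f \<in> Fcls m B" and g: "g \<in> Fcls m B" and eq: "\<And>x. x \<in> set xs \<Longrightarrow> f x = g x"
      show "D (S f) (S g) \<le> ereal (\<psi> (2 * C * ?h))"
      proof (rule D)
        fix x :: "real^'d" assume x: "x \<in> cube"
        have "Cm_bdd m (B + B) cube (\<lambda>x. f x - g x)" 
          using Cm_bdd_diff[of m B cube f B g] f g by (simp only: Fcls_def mem_Collect_eq)
        from X[OF this _ x] show "\<bar>f x - g x\<bar> \<le> 2 * C * ?h" using eq by (simp add: algebra_simps)
      qed (use f g Fcls_continuous_on C0 B n in auto)
    qed
  qed (use C0 in simp)
qed

lemma err_ad_lower:
  fixes S :: "(real^'d \<Rightarrow> real) \<Rightarrow> 'o" and \<Phi> :: "'o \<Rightarrow> real" and i :: 'd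
  assumes lip: "\<And>f Q. continuous_on cube f \<Longrightarrow> Q \<in> Out \<Longrightarrow> ereal \<bar>\<Phi> (S f) - \<Phi> Q\<bar> \<le> D (S f) Q"
    and gap: "\<And>f y. continuous_on cube f \<Longrightarrow> (\<And>x. x \<in> right_half i \<Longrightarrow> f x = 0) \<Longrightarrow> 0 < y \<Longrightarrow>
       exp y \<le> Zf f \<Longrightarrow> \<psi> y \<le> \<bar>\<Phi> (S f) - \<Phi> (S (\<lambda>_. 0))\<bar>"
  shows "\<exists>c>0. \<forall>B>0. \<forall>n\<ge>1. ereal (\<psi> (c * (B * real n powr (- (real m / real CARD('d))))) / 2)
      \<le> err_ad n cube (Fcls m B) S Out D"
proof -
  obtain \<eta> where \<eta>0: "\<eta> > 0" and \<eta>: "\<forall>B>0. \<forall>n\<ge>1. \<forall>pts :: (real^'d) set. finite pts \<longrightarrow> card pts \<le> n \<longrightarrow>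
    (\<exists>f. Cm_bdd m B cube f \<and> (\<forall>p\<in>pts. f p = 0) \<and> (\<forall>x. x $ i > 1/2 \<longrightarrow> f x = 0) \<and>
       \<eta> * (B * real n powr (- (real m / real CARD('d)))) \<le> (LINT x:cube|lborel. f x))"
    using fooling_function[of m i] by (elim exE conjE) (rule that)
  show ?thesis
  proof (intro exI[of _ \<eta>] conjI allI impI)
    fix B :: real and n :: nat assume B: "B > 0" and n: "n \<ge> 1"
    let ?h = "B * real n powr (- (real m / real CARD('d)))"
    show "ereal (\<psi> (\<eta> * ?h) / 2) \<le> err_ad n cube (Fcls m B) S Out D"
    proof (rule err_ad_ge_functional[where \<Phi> = \<Phi>, OF zero_in_Fcls[OF B]])
      fix pts :: "(real^'d) set" assume pts: "finite pts" "card pts \<le> n"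
      obtain f where f: "Cm_bdd m B cube f" "\<forall>p\<in>pts. f p = 0" "\<forall>x. x $ i > 1/2 \<longrightarrow> f x = 0"
        "\<eta> * ?h \<le> (LINT x:cube|lborel. f x)" using \<eta>[rule_format, OF B n pts] by blast
      have cf: "continuous_on cube f" by (rule Cm_bdd_continuous_on[OF f(1)])
      have "exp (\<eta> * ?h) \<le> exp (LINT x:cube|lborel. f x)" using f(4) by simp
      also have "\<dots> \<le> Zf f" by (rule exp_integral_le_Zf[OF cf])
      finally have "\<psi> (\<eta> * ?h) \<le> \<bar>\<Phi> (S f) - \<Phi> (S (\<lambda>_. 0))\<bar>"
        using f(3) B n \<eta>0 by (intro gap cf) (auto simp: right_half_def)
      then show "\<exists>f\<in>Fcls m B. (\<forall>x\<in>pts. f x = 0) \<and> 2 * (\<psi> (\<eta> * ?h) / 2) \<le> \<bar>\<Phi> (S f) - \<Phi> (S (\<lambda>_. 0))\<bar>"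
        using f(1,2) by (auto simp: Fcls_def)
    qed (use lip Fcls_continuous_on in blast)
  qed (rule \<eta>0)
qed

lemma measure_Pf_right_half:
  fixes i :: "'d::finite"
  assumes "continuous_on cube f" "\<And>x. x \<in> right_half i \<Longrightarrow> f x = 0"
  shows "measure (Pf f) (right_half i) = measure (Pf (\<lambda>_. 0)) (right_half i) / Zf f"
proof -
  have "f x = 0 \<or> indicator (right_half i) x = (0 :: real)" for x
    using assms(2) by (auto simp: indicator_def)
  from integral_Pf_eq_divide_Zf[OF assms(1) _ this] show ?thesis
    by (simp add: integral_indicator_Pf del: Bochner_Integration.integral_indicator)
qed

lemma measure_Pf_right_half_pos:
  fixes i :: "'d::finite"
  assumes "continuous_on cube f"
  shows "0 < measure (Pf f) (right_half i)"
proof -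
  have "bounded (f ` cube)" using assms compact_cube by (intro compact_imp_bounded compact_continuous_image)
  then obtain c where "\<forall>y\<in>f ` cube. norm y \<le> c" unfolding bounded_iff by blast
  then have "\<And>x. x \<in> cube \<Longrightarrow> \<bar>f x - 0\<bar> \<le> c" by auto
  from measure_Pf_ratio[OF assms continuous_on_const this right_half_borel]
  have "exp (- (2 * c)) * measure (Pf (\<lambda>_. 0)) (right_half i) \<le> measure (Pf f) (right_half i)" .
  moreover have "0 < exp (- (2 * c)) * measure (Pf (\<lambda>_. 0)) (right_half i)"
    using right_half_pos[of i] by simp
  ultimately show ?thesis by linarith
qed

lemma one_minus_inverse_ge:
  fixes y z :: real
  assumes "0 < y" "exp y \<le> z"
  shows "min 1 y / 2 \<le> 1 - 1 / z"
proof -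
  have z: "1 + y \<le> z" using exp_ge_add_one_self[of y] assms by linarith
  have "1 / z \<le> 1 / (1 + y)" using z assms by (intro divide_left_mono) auto
  moreover have "min 1 y / 2 \<le> y / (1 + y)"
    using assms by (auto simp: min_def field_simps intro: mult_left_le)
  moreover have "y / (1 + y) = 1 - 1 / (1 + y)" using assms by (simp add: field_simps)
  ultimately show ?thesis by linarith
qed

lemma min_one_mult_le:
  fixes C h :: real
  assumes "0 \<le> h" "0 \<le> C"
  shows "min 1 (C * h) \<le> (1 + C) * min 1 h"
  using assms by (auto simp: min_def algebra_simps mult_left_le)

lemma min_one_mult_ge:
  fixes c h :: real
  assumes "0 \<le> h" "0 \<le> c"
  shows "min 1 c * min 1 h \<le> min 1 (c * h)"
  using assms by (intro min.boundedI mult_le_one mult_mono) auto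

context
  fixes m :: nat
begin

abbreviation (input) rate :: "'d::finite itself \<Rightarrow> real \<Rightarrow> nat \<Rightarrow> real" where
  "rate d B n \<equiv> B * real n powr (- (real m / real CARD('d)))"

lemma Theta_Lf:
  "Theta (\<lambda>B n. err_na n (cube :: (real^'d) set) (Fcls m B) Lf UNIV abs_dist) (rate TYPE('d)) \<and>
   Theta (\<lambda>B n. err_ad n (cube :: (real^'d) set) (Fcls m B) Lf UNIV abs_dist) (rate TYPE('d))"
proof (rule Theta_pairI)
  show "\<exists>C>0. \<forall>B>0. \<forall>n\<ge>1. err_na n (cube :: (real^'d) set) (Fcls m B) Lf UNIV abs_dist \<le> ereal (C * rate TYPE('d) B n)"
    by (rule err_na_upper[where \<psi> = "\<lambda>\<delta>. \<delta>"]) (auto simp: abs_dist_def intro: Lf_diff_le)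
  have "\<exists>c>0. \<forall>B>0. \<forall>n\<ge>1. ereal (c * rate TYPE('d) B n / 2) \<le> err_ad n (cube :: (real^'d) set) (Fcls m B) Lf UNIV abs_dist"
  proof (rule err_ad_lower[where \<psi> = "\<lambda>y. y" and \<Phi> = "\<lambda>y. y" and i = undefined])
    fix f :: "real^'d \<Rightarrow> real" and y :: real assume f: "continuous_on cube f" "exp y \<le> Zf f"
    have "ln (exp y) \<le> ln (Zf f)" using f Zf_pos[OF f(1)] by (subst ln_le_cancel_iff) auto
    then show "y \<le> \<bar>Lf f - Lf (\<lambda>_. 0)\<bar>" by (simp add: Lf_def Zf_const)
  qed (simp add: abs_dist_def)
  then obtain c where "c > 0" "\<forall>B>0. \<forall>n\<ge>1. ereal (c / 2 * rate TYPE('d) B n) \<le> err_ad n (cube :: (real^'d) set) (Fcls m B) Lf UNIV abs_dist"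
    by auto
  then show "\<exists>c>0. \<forall>B>0. \<forall>n\<ge>1. ereal (c * rate TYPE('d) B n) \<le> err_ad n (cube :: (real^'d) set) (Fcls m B) Lf UNIV abs_dist"
    by (intro exI[of _ "c / 2"]) auto
qed (use cube_zero in \<open>auto intro!: err_ad_le_err_na\<close>)

lemma Theta_suplog:
  "Theta (\<lambda>B n. err_na n (cube :: (real^'d) set) (Fcls m B) Pf Dists suplog_dist) (rate TYPE('d)) \<and>
   Theta (\<lambda>B n. err_ad n (cube :: (real^'d) set) (Fcls m B) Pf Dists suplog_dist) (rate TYPE('d))"
proof (rule Theta_pairI)
  have "\<exists>C>0. \<forall>B>0. \<forall>n\<ge>1. err_na n (cube :: (real^'d) set) (Fcls m B) Pf Dists suplog_dist \<le> ereal (2 * (C * rate TYPE('d) B n))"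
    by (rule err_na_upper[where \<psi> = "\<lambda>\<delta>. 2 * \<delta>"]) (auto intro: suplog_dist_Pf_le Pf_in_Dists)
  then obtain C where "C > 0" "\<forall>B>0. \<forall>n\<ge>1. err_na n (cube :: (real^'d) set) (Fcls m B) Pf Dists suplog_dist \<le> ereal (2 * C * rate TYPE('d) B n)"
    by (auto simp: mult.assoc)
  then show "\<exists>C>0. \<forall>B>0. \<forall>n\<ge>1. err_na n (cube :: (real^'d) set) (Fcls m B) Pf Dists suplog_dist \<le> ereal (C * rate TYPE('d) B n)"
    by (intro exI[of _ "2 * C"]) auto
  let ?i = "undefined :: 'd"
  have "\<exists>c>0. \<forall>B>0. \<forall>n\<ge>1. ereal (c * rate TYPE('d) B n / 2) \<le> err_ad n (cube :: (real^'d) set) (Fcls m B) Pf Dists suplog_dist"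
  proof (rule err_ad_lower[where \<psi> = "\<lambda>y. y" and \<Phi> = "\<lambda>P. ln (measure P (right_half ?i))" and i = ?i])
    fix f :: "real^'d \<Rightarrow> real" and Q :: "(real^'d) measure" assume "continuous_on cube f" "Q \<in> Dists"
    then show "ereal \<bar>ln (measure (Pf f) (right_half ?i)) - ln (measure Q (right_half ?i))\<bar> \<le> suplog_dist (Pf f) Q"
      by (intro suplog_dist_ge Pf_in_Dists measure_Pf_right_half_pos) auto
  next
    fix f :: "real^'d \<Rightarrow> real" and y :: real
    assume f: "continuous_on cube f" "\<And>x. x \<in> right_half ?i \<Longrightarrow> f x = 0" "exp y \<le> Zf f"
    have "ln (exp y) \<le> ln (Zf f)" using f Zf_pos[OF f(1)] by (subst ln_le_cancel_iff) auto
    then show "y \<le> \<bar>ln (measure (Pf f) (right_half ?i)) - ln (measure (Pf (\<lambda>_. 0)) (right_half ?i))\<bar>"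
      using right_half_pos[of ?i] Zf_pos[OF f(1)] by (simp add: measure_Pf_right_half[OF f(1,2)] ln_div)
  qed
  then obtain c where "c > 0" "\<forall>B>0. \<forall>n\<ge>1. ereal (c / 2 * rate TYPE('d) B n) \<le> err_ad n (cube :: (real^'d) set) (Fcls m B) Pf Dists suplog_dist"
    by auto
  then show "\<exists>c>0. \<forall>B>0. \<forall>n\<ge>1. ereal (c * rate TYPE('d) B n) \<le> err_ad n (cube :: (real^'d) set) (Fcls m B) Pf Dists suplog_dist"
    by (intro exI[of _ "c / 2"]) auto
qed (use cube_zero in \<open>auto intro!: err_ad_le_err_na\<close>)

lemma Theta_min_rateI:
  fixes D :: "(real^'d) measure \<Rightarrow> (real^'d) measure \<Rightarrow> ereal" and \<Phi> :: "(real^'d) measure \<Rightarrow> real" and i :: 'd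
  assumes A: "0 < A" "\<And>f g \<delta>. continuous_on cube f \<Longrightarrow> continuous_on cube g \<Longrightarrow>
      (\<And>x. x \<in> cube \<Longrightarrow> \<bar>f x - g x\<bar> \<le> \<delta>) \<Longrightarrow> 0 < \<delta> \<Longrightarrow> D (Pf f) (Pf g) \<le> ereal (A * min 1 (2 * \<delta>))"
    and lip: "\<And>P Q. P \<in> Dists \<Longrightarrow> Q \<in> Dists \<Longrightarrow> ereal \<bar>\<Phi> P - \<Phi> Q\<bar> \<le> D P Q"
    and \<Phi>0: "0 < \<Phi> (Pf (\<lambda>_. 0))"
    and \<Phi>: "\<And>f. continuous_on cube f \<Longrightarrow> (\<And>x. x \<in> right_half i \<Longrightarrow> f x = 0) \<Longrightarrow> \<Phi> (Pf f) = \<Phi> (Pf (\<lambda>_. 0)) / Zf f"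
  shows "Theta (\<lambda>B n. err_na n (cube :: (real^'d) set) (Fcls m B) Pf Dists D) (\<lambda>B n. min 1 (rate TYPE('d) B n)) \<and>
   Theta (\<lambda>B n. err_ad n (cube :: (real^'d) set) (Fcls m B) Pf Dists D) (\<lambda>B n. min 1 (rate TYPE('d) B n))"
proof (rule Theta_pairI)
  have "\<exists>C>0. \<forall>B>0. \<forall>n\<ge>1. err_na n (cube :: (real^'d) set) (Fcls m B) Pf Dists D \<le> ereal (A * min 1 (2 * (C * rate TYPE('d) B n)))"
    by (rule err_na_upper[where \<psi> = "\<lambda>\<delta>. A * min 1 (2 * \<delta>)"]) (auto intro: A(2) Pf_in_Dists)
  then obtain C where C: "C > 0" "\<And>B n. B > 0 \<Longrightarrow> n \<ge> 1 \<Longrightarrow>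
      err_na n (cube :: (real^'d) set) (Fcls m B) Pf Dists D \<le> ereal (A * min 1 (2 * (C * rate TYPE('d) B n)))"
    by blast
  show "\<exists>C>0. \<forall>B>0. \<forall>n\<ge>1. err_na n (cube :: (real^'d) set) (Fcls m B) Pf Dists D \<le> ereal (C * min 1 (rate TYPE('d) B n))"
  proof (intro exI[of _ "A * (1 + 2 * C)"] conjI allI impI)
    fix B :: real and n :: nat assume "B > 0" "n \<ge> 1"
    note C(2)[OF this]
    also have "A * min 1 (2 * (C * rate TYPE('d) B n)) \<le> A * (1 + 2 * C) * min 1 (rate TYPE('d) B n)"
      using min_one_mult_le[of "rate TYPE('d) B n" "2 * C"] A(1) C(1) \<open>B > 0\<close> by (simp add: mult.assoc)
    finally show "err_na n (cube :: (real^'d) set) (Fcls m B) Pf Dists D \<le> ereal (A * (1 + 2 * C) * min 1 (rate TYPE('d) B n))"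
      by simp
  qed (use A C in simp)
  let ?k = "\<Phi> (Pf (\<lambda>_. 0))"
  have "\<exists>c>0. \<forall>B>0. \<forall>n\<ge>1. ereal (?k * (min 1 (c * rate TYPE('d) B n) / 2) / 2) \<le> err_ad n (cube :: (real^'d) set) (Fcls m B) Pf Dists D"
  proof (rule err_ad_lower[where \<psi> = "\<lambda>y. ?k * (min 1 y / 2)" and \<Phi> = \<Phi> and i = i])
    show "ereal \<bar>\<Phi> (Pf f) - \<Phi> Q\<bar> \<le> D (Pf f) Q" if "continuous_on cube f" "Q \<in> Dists" for f Q
      using that by (intro lip Pf_in_Dists)
  next
    fix f :: "real^'d \<Rightarrow> real" and y :: real
    assume f: "continuous_on cube f" "\<And>x. x \<in> right_half i \<Longrightarrow> f x = 0" "0 < y" "exp y \<le> Zf f"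
    have "?k * (min 1 y / 2) \<le> ?k * (1 - 1 / Zf f)"
      using \<Phi>0 one_minus_inverse_ge[OF f(3,4)] by (intro mult_left_mono) auto
    also have "\<dots> = - (\<Phi> (Pf f) - ?k)" by (simp add: \<Phi>[OF f(1,2)] algebra_simps)
    finally show "?k * (min 1 y / 2) \<le> \<bar>\<Phi> (Pf f) - ?k\<bar>" by linarith
  qed
  then obtain c where c: "c > 0" "\<And>B n. B > 0 \<Longrightarrow> n \<ge> 1 \<Longrightarrow>
      ereal (?k * (min 1 (c * rate TYPE('d) B n) / 2) / 2) \<le> err_ad n (cube :: (real^'d) set) (Fcls m B) Pf Dists D" by blast
  show "\<exists>c>0. \<forall>B>0. \<forall>n\<ge>1. ereal (c * min 1 (rate TYPE('d) B n)) \<le> err_ad n (cube :: (real^'d) set) (Fcls m B) Pf Dists D"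
  proof (intro exI[of _ "?k * min 1 c / 4"] conjI allI impI)
    fix B :: real and n :: nat assume Bn: "B > 0" "n \<ge> 1"
    have "?k * (min 1 c * min 1 (rate TYPE('d) B n)) \<le> ?k * min 1 (c * rate TYPE('d) B n)"
      using min_one_mult_ge[of "rate TYPE('d) B n" c] \<Phi>0 c(1) Bn by (intro mult_left_mono) auto
    then have "ereal (?k * min 1 c / 4 * min 1 (rate TYPE('d) B n)) \<le> ereal (?k * (min 1 (c * rate TYPE('d) B n) / 2) / 2)"
      by simp
    also note c(2)[OF Bn]
    finally show "ereal (?k * min 1 c / 4 * min 1 (rate TYPE('d) B n)) \<le> err_ad n (cube :: (real^'d) set) (Fcls m B) Pf Dists D" .
  qed (use \<Phi>0 c in simp)
qed (use cube_zero in \<open>auto intro!: err_ad_le_err_na\<close>)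

lemma Theta_tv:
  "Theta (\<lambda>B n. err_na n (cube :: (real^'d) set) (Fcls m B) Pf Dists tv_dist) (\<lambda>B n. min 1 (rate TYPE('d) B n)) \<and>
   Theta (\<lambda>B n. err_ad n (cube :: (real^'d) set) (Fcls m B) Pf Dists tv_dist) (\<lambda>B n. min 1 (rate TYPE('d) B n))"
proof (rule Theta_min_rateI[where A = 1 and i = undefined and \<Phi> = "\<lambda>P. measure P (right_half undefined)"])
  fix f g :: "real^'d \<Rightarrow> real" and \<delta> :: real
  assume "continuous_on cube f" "continuous_on cube g" "\<And>x. x \<in> cube \<Longrightarrow> \<bar>f x - g x\<bar> \<le> \<delta>"
  from tv_dist_Pf_le[OF this] show "tv_dist (Pf f) (Pf g) \<le> ereal (1 * min 1 (2 * \<delta>))" by (simp only: mult_1)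
qed (blast intro: zero_less_one tv_dist_ge right_half_pos measure_Pf_right_half right_half_borel)+

lemma Theta_w1:
  "Theta (\<lambda>B n. err_na n (cube :: (real^'d) set) (Fcls m B) Pf Dists w1_dist) (\<lambda>B n. min 1 (rate TYPE('d) B n)) \<and>
   Theta (\<lambda>B n. err_ad n (cube :: (real^'d) set) (Fcls m B) Pf Dists w1_dist) (\<lambda>B n. min 1 (rate TYPE('d) B n))"
proof (rule Theta_min_rateI[where A = "real CARD('d)" and i = undefined and \<Phi> = "\<lambda>P. LINT x|P. ramp (undefined :: 'd) x"])
  fix f :: "real^'d \<Rightarrow> real" assume f: "continuous_on cube f" "\<And>x. x \<in> right_half undefined \<Longrightarrow> f x = 0"
  have z: "f x = 0 \<or> ramp (undefined :: 'd) x = 0" for x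
    using f(2)[of x] by (auto simp: right_half_def ramp_def)
  show "(LINT x|Pf f. ramp (undefined :: 'd) x) = (LINT x|Pf (\<lambda>_. 0). ramp (undefined :: 'd) x) / Zf f"
    by (rule integral_Pf_eq_divide_Zf[OF f(1) ramp_borel z])
next
  show "ereal \<bar>(LINT x|P. ramp (undefined :: 'd) x) - (LINT x|Q. ramp (undefined :: 'd) x)\<bar> \<le> w1_dist P Q" for P Q :: "(real^'d) measure"
    using ramp_bounds[of "undefined :: 'd"] by (intro w1_dist_ge ramp_borel ramp_lipschitz) auto
qed (simp_all only: w1_dist_Pf_le ramp_integral_pos of_nat_0_less_iff zero_less_card_finite)

end

theorem theorem4:
  fixes m :: nat
  assumes "m \<ge> 1"
  shows
   "Theta (\<lambda>B n. err_na n (cube :: (real^'d) set) (Fcls m B) Lf UNIV abs_dist)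
          (\<lambda>B n. B * real n powr (- (real m / real CARD('d)))) \<and>
    Theta (\<lambda>B n. err_ad n (cube :: (real^'d) set) (Fcls m B) Lf UNIV abs_dist)
          (\<lambda>B n. B * real n powr (- (real m / real CARD('d)))) \<and>
    Theta (\<lambda>B n. err_na n (cube :: (real^'d) set) (Fcls m B) Pf Dists suplog_dist)
          (\<lambda>B n. B * real n powr (- (real m / real CARD('d)))) \<and>
    Theta (\<lambda>B n. err_ad n (cube :: (real^'d) set) (Fcls m B) Pf Dists suplog_dist)
          (\<lambda>B n. B * real n powr (- (real m / real CARD('d)))) \<and>
    Theta (\<lambda>B n. err_na n (cube :: (real^'d) set) (Fcls m B) Pf Dists tv_dist)
          (\<lambda>B n. min 1 (B * real n powr (- (real m / real CARD('d))))) \<and>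
    Theta (\<lambda>B n. err_ad n (cube :: (real^'d) set) (Fcls m B) Pf Dists tv_dist)
          (\<lambda>B n. min 1 (B * real n powr (- (real m / real CARD('d))))) \<and>
    Theta (\<lambda>B n. err_na n (cube :: (real^'d) set) (Fcls m B) Pf Dists w1_dist)
          (\<lambda>B n. min 1 (B * real n powr (- (real m / real CARD('d))))) \<and>
    Theta (\<lambda>B n. err_ad n (cube :: (real^'d) set) (Fcls m B) Pf Dists w1_dist)
          (\<lambda>B n. min 1 (B * real n powr (- (real m / real CARD('d)))))"
  using Theta_Lf[of m] Theta_suplog[of m] Theta_tv[of m] Theta_w1[of m] by blast

end
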